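(* For $N\in\mathbb{N}$ let $\mathfrak{Z}_N=\int_{\mathbb{S}^{N-1}(\sqrt N)}\sum_{i=1}^N|v_i|^N\,d\sigma^N$ and $$F_N(v_1,\dots,v_N)=\frac{\sum_{i=1}^N|v_i|^N}{\mathfrak{Z}_N},\qquad (v_1,\dots,v_N)\in\mathbb{S}^{N-1}(\sqrt N).$$ Then the family $\{F_N\}_{N\in\mathbb{N}}$ is $M_{\frac12}$-chaotic but not entropically chaotic, where $M_{\frac12}(v)=\frac{e^{-v^2}}{\sqrt{\pi}}$.
   Context: $\mathbb{S}^{N-1}(\sqrt N)\subset\mathbb{R}^N$ is the sphere of radius $\sqrt N$ centered at the origin (Kac's sphere) and $d\sigma^N$ is the uniform probability measure on it. A probability density on $\mathbb{S}^{N-1}(\sqrt N)$ is taken with respect to $d\sigma^N$; it is symmetric if it is invariant under all permutations of the coordinates $v_1,\dots,v_N$. A family $\{F_N\}$ of symmetric probability densities on $\mathbb{S}^{N-1}(\sqrt N)$ is $f$-chaotic, where $f$ is a probability density on $\mathbb{R}$, if for every $k\in\mathbb{N}$ the $k$-th marginals $\Pi_k(F_N)$ (the law of $(v_1,\dots,v_k)$ under $F_N\,d\sigma^N$, $N\ge k$) converge as $N\to\infty$ to $f^{\otimes k}(v_1,\dots,v_k)=\prod_{i=1}^k f(v_i)$ weakly, i.e. for every bounded continuous $\phi$ on $\mathbb{R}^k$, $\int_{\mathbb{S}^{N-1}(\sqrt N)}F_N\,\phi(v_1,\dots,v_k)\,d\sigma^N\to\int_{\mathbb{R}^k}f^{\otimes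 k}\phi\,dv_1\cdots dv_k$. Let $H_N(F_N)=\int_{\mathbb{S}^{N-1}(\sqrt N)}F_N\log F_N\,d\sigma^N$, let $\gamma(x)=e^{-x^2/2}/\sqrt{2\pi}$, and let $H(f|\gamma)=\int_{\mathbb{R}}f\log(f/\gamma)\,dx$. The family $\{F_N\}$ is ($f$-)entropically chaotic if it is $f$-chaotic and $\lim_{N\to\infty}H_N(F_N)/N=H(f|\gamma)$. *)

theory Defs
  imports "HOL-Probability.Probability"
begin

text \<open>
  Points of \<open>\<real>\<^sup>N\<close> are the functions in \<open>{..<N} \<rightarrow>\<^sub>E UNIV\<close>, so coordinates are numbered
  from \<open>0\<close>.  On this set the topology of the function type \<open>nat \<Rightarrow> real\<close> is the
  usual topology of \<open>\<real>\<^sup>N\<close>.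
\<close>

definition kac_sphere :: "nat \<Rightarrow> (nat \<Rightarrow> real) set" where
  "kac_sphere N = {v \<in> {..<N} \<rightarrow>\<^sub>E UNIV. (\<Sum>i<N. (v i)\<^sup>2) = real N}"

definition punctured_ball :: "nat \<Rightarrow> (nat \<Rightarrow> real) set" where
  "punctured_ball N = {x \<in> {..<N} \<rightarrow>\<^sub>E UNIV. 0 < (\<Sum>i<N. (x i)\<^sup>2) \<and> (\<Sum>i<N. (x i)\<^sup>2) \<le> real N}"

definition radial_projection :: "nat \<Rightarrow> (nat \<Rightarrow> real) \<Rightarrow> (nat \<Rightarrow> real)" where
  "radial_projection N x = (\<lambda>i\<in>{..<N}. sqrt (real N) * x i / sqrt (\<Sum>j<N. (x j)\<^sup>2))"

text \<open>
  The uniform probability measure on the sphere, as the normalised cone measure: the measure of \<open>A\<close>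
  is the proportion of the volume of the ball of radius \<open>\<surd>N\<close> taken up by the cone
  \<open>{t v | v \<in> A, 0 < t \<le> 1}\<close>.  For a Euclidean sphere this is the normalised surface measure.
  The origin is removed because the radial projection is undefined there; its volume is zero
  for \<open>N \<ge> 1\<close>.  The measure space has the sphere itself as its carrier.
\<close>

definition sphere_measure :: "nat \<Rightarrow> (nat \<Rightarrow> real) measure" where
  "sphere_measure N =
     distr (uniform_measure (restrict_space (\<Pi>\<^sub>M i\<in>{..<N}. lborel) (punctured_ball N)) (punctured_ball N))
       (restrict_space (\<Pi>\<^sub>M i\<in>{..<N}. borel) (kac_sphere N))
       (radial_projection N)"

definition symmetric_density :: "nat \<Rightarrow> ((nat \<Rightarrow> real) \<Rightarrow> real) \<Rightarrow> bool" where
  "symmetric_density N F \<longleftrightarrow>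
     (\<forall>v\<in>kac_sphere N. 0 \<le> F v) \<and>
     has_bochner_integral (sphere_measure N) F 1 \<and>
     (\<forall>p. p permutes {..<N} \<longrightarrow> (\<forall>v\<in>kac_sphere N. F (v \<circ> p) = F v))"

definition real_density :: "(real \<Rightarrow> real) \<Rightarrow> bool" where
  "real_density f \<longleftrightarrow> (\<forall>x. 0 \<le> f x) \<and> has_bochner_integral lborel f 1"

text \<open>
  The family is indexed by \<open>N \<ge> 1\<close>; the value at \<open>N = 0\<close> is ignored.  The integrand is meant for
  \<open>N \<ge> k\<close> only, which the limit ensures.
\<close>

definition chaotic :: "(real \<Rightarrow> real) \<Rightarrow> (nat \<Rightarrow> (nat \<Rightarrow> real) \<Rightarrow> real) \<Rightarrow> bool" where
  "chaotic f F \<longleftrightarrow>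
     real_density f \<and> (\<forall>N\<ge>1. symmetric_density N (F N)) \<and>
     (\<forall>k\<ge>1. \<forall>\<phi> :: (nat \<Rightarrow> real) \<Rightarrow> real.
        continuous_on ({..<k} \<rightarrow>\<^sub>E UNIV) \<phi> \<longrightarrow> bounded (\<phi> ` ({..<k} \<rightarrow>\<^sub>E UNIV)) \<longrightarrow>
        (\<lambda>N. \<integral>v. F N v * \<phi> (restrict v {..<k}) \<partial>sphere_measure N)
          \<longlonglongrightarrow> (\<integral>x. (\<Prod>i<k. f (x i)) * \<phi> x \<partial>(\<Pi>\<^sub>M i\<in>{..<k}. lborel)))"

text \<open>
  The entropies take the value \<open>\<infinity>\<close> when the positive part of the integrand is not integrable,
  where a Bochner integral would return \<open>0\<close>.  The negative parts always have finite integral: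
  \<open>t log t \<ge> - 1 / e\<close>, and both reference measures are probability measures.
\<close>

definition ext_integral :: "'a measure \<Rightarrow> ('a \<Rightarrow> real) \<Rightarrow> ereal" where
  "ext_integral M g =
     enn2ereal (\<integral>\<^sup>+ x. ennreal (g x) \<partial>M) - enn2ereal (\<integral>\<^sup>+ x. ennreal (- g x) \<partial>M)"

definition sphere_entropy :: "nat \<Rightarrow> ((nat \<Rightarrow> real) \<Rightarrow> real) \<Rightarrow> ereal" where
  "sphere_entropy N F = ext_integral (sphere_measure N) (\<lambda>v. F v * ln (F v))"

definition gaussian_relative_entropy :: "(real \<Rightarrow> real) \<Rightarrow> ereal" where
  "gaussian_relative_entropy f =
     ext_integral lborel (\<lambda>x. f x * ln (f x / std_normal_density x))"

definition entropically_chaotic ::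
    "(real \<Rightarrow> real) \<Rightarrow> (nat \<Rightarrow> (nat \<Rightarrow> real) \<Rightarrow> real) \<Rightarrow> bool" where
  "entropically_chaotic f F \<longleftrightarrow>
     chaotic f F \<and>
     (\<lambda>N. sphere_entropy N (F N) / ereal (real N)) \<longlonglongrightarrow> gaussian_relative_entropy f"

lemma radial_projection_in_sphere:
  assumes "N \<ge> 1" "x \<in> punctured_ball N"
  shows "radial_projection N x \<in> kac_sphere N"
proof -
  define s where "s = (\<Sum>i<N. (x i)\<^sup>2)"
  have s: "s > 0" using assms by (auto simp: punctured_ball_def s_def)
  have "(\<Sum>i<N. (radial_projection N x i)\<^sup>2) = (\<Sum>i<N. real N / s * (x i)\<^sup>2)"
    using s by (intro sum.cong)
      (auto simp: radial_projection_def power_mult_distrib power_divide s_def[symmetric])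
  also have "\<dots> = real N / s * s"
    unfolding s_def by (rule sum_distrib_left[symmetric])
  also have "\<dots> = real N" using s by simp
  finally show ?thesis by (auto simp: kac_sphere_def radial_projection_def)
qed

lemma prob_space_sphere_measure:
  assumes "N \<ge> 1"
  shows "prob_space (sphere_measure N)"
proof -
  interpret product_sigma_finite "\<lambda>_::nat. lborel :: real measure" ..
  let ?L = "\<Pi>\<^sub>M i\<in>{..<N}. (lborel :: real measure)"
  let ?B = "punctured_ball N"
  have sp: "space ?L = {..<N} \<rightarrow>\<^sub>E UNIV" by (simp add: space_PiM)
  have "?B = {x \<in> space ?L. 0 < (\<Sum>i<N. (x i)\<^sup>2) \<and> (\<Sum>i<N. (x i)\<^sup>2) \<le> real N}"
    unfolding sp punctured_ball_def ..
  also have "\<dots> \<in> sets ?L" by measurable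
  finally have B: "?B \<in> sets ?L" .
  have cube: "emeasure ?L (Pi\<^sub>E {..<N} (\<lambda>_. {a..b})) = ennreal ((b - a) ^ N)" if "a \<le> b" for a b :: real
    using that by (subst emeasure_PiM) (auto simp: ennreal_power)
  have "Pi\<^sub>E {..<N} (\<lambda>_. {1/2..1}) \<subseteq> ?B"
  proof
    fix x :: "nat \<Rightarrow> real" assume x: "x \<in> Pi\<^sub>E {..<N} (\<lambda>_. {1/2..1})"
    have *: "1/2 \<le> x i" "x i \<le> 1" if "i < N" for i using x that by (auto simp: PiE_iff)
    have "0 < (\<Sum>i<N. (x i)\<^sup>2)"
      using assms by (intro sum_pos) (auto dest!: *(1) simp: lessThan_empty_iff)
    moreover have "(\<Sum>i<N. (x i)\<^sup>2) \<le> (\<Sum>i<N. 1)"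
      by (intro sum_mono power_le_one) (use * in force)+
    ultimately show "x \<in> ?B" using x by (auto simp: punctured_ball_def PiE_iff)
  qed
  from emeasure_mono[OF this B] have "ennreal ((1 - 1 / 2) ^ N) \<le> emeasure ?L ?B"
    by (subst (asm) cube) auto
  moreover have "0 < ennreal ((1 - 1 / 2) ^ N)"
    by (subst ennreal_less_zero_iff) (rule zero_less_power, simp)
  ultimately have pos: "emeasure ?L ?B \<noteq> 0" by auto
  have "?B \<subseteq> Pi\<^sub>E {..<N} (\<lambda>_. {- real N..real N})"
  proof
    fix x :: "nat \<Rightarrow> real" assume x: "x \<in> ?B"
    have "\<bar>x i\<bar> \<le> real N" if "i < N" for i
    proof -
      have "(x i)\<^sup>2 \<le> (\<Sum>i<N. (x i)\<^sup>2)" using that by (intro member_le_sum) auto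
      also have "\<dots> \<le> (real N)\<^sup>2"
        using x assms by (auto simp: punctured_ball_def power2_eq_square intro: order_trans)
      finally show ?thesis by (simp add: abs_le_square_iff[symmetric])
    qed
    then show "x \<in> Pi\<^sub>E {..<N} (\<lambda>_. {- real N..real N})"
      using x by (auto simp: punctured_ball_def PiE_iff abs_le_iff minus_le_iff)
  qed
  then have "emeasure ?L ?B \<le> emeasure ?L (Pi\<^sub>E {..<N} (\<lambda>_. {- real N..real N}))"
    by (rule emeasure_mono) (auto intro!: sets_PiM_I_finite)
  then have "emeasure ?L ?B \<le> ennreal ((real N - - real N) ^ N)"
    by (subst (asm) cube) auto
  then have fin: "emeasure ?L ?B \<noteq> \<infinity>" by (auto simp: top_unique)
  let ?R = "restrict_space ?L ?B"
  have eR: "emeasure ?R ?B = emeasure ?L ?B"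
    using B by (subst emeasure_restrict_space) auto
  interpret U: prob_space "uniform_measure ?R ?B"
    by (intro prob_space_uniform_measure) (use eR pos fin in auto)
  have "radial_projection N \<in> ?L \<rightarrow>\<^sub>M (\<Pi>\<^sub>M i\<in>{..<N}. borel)"
    unfolding radial_projection_def by measurable
  then have "radial_projection N \<in> ?R \<rightarrow>\<^sub>M restrict_space (\<Pi>\<^sub>M i\<in>{..<N}. borel) (kac_sphere N)"
    by (intro measurable_restrict_space2 measurable_restrict_space1)
       (use assms in \<open>auto simp: space_restrict_space radial_projection_in_sphere\<close>)
  then show ?thesis
    unfolding sphere_measure_def by (intro U.prob_space_distr) simp
qed

end

theory Submission
  imports Defs "HOL-Real_Asymp.Real_Asymp"
begin

text \<open>
  Let \<open>\<pi>\<close> be the radial projection onto the sphere.  Since \<open>x / |x|\<close> and \<open>|x|\<close> are independent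
  under any rotation invariant density, weighting the uniform measure on the sphere by
  \<open>|v\<^sub>j|\<^sup>p\<close> amounts to projecting a product measure: all coordinates have density
  proportional to \<open>exp (- x\<^sup>2)\<close>, except coordinate \<open>j\<close>, which has density proportional to
  \<open>|x|\<^sup>p exp (- x\<^sup>2)\<close>.  Hence \<open>F\<^sub>N\<close> is the average over \<open>j\<close> of the projections of these
  products with \<open>p = N\<close>.  In such a product \<open>x\<^sub>j\<^sup>2 \<approx> N / 2\<close> and \<open>|x|\<^sup>2 \<approx> N\<close>
  with variance of order \<open>N\<close>, so \<open>\<pi>\<close> leaves every fixed group of the other coordinates nearly
  unchanged; this is chaoticity.

  On the other hand \<open>F\<^sub>N\<close> concentrates on the event that some \<open>v\<^sub>j\<^sup>2\<close> exceeds \<open>2 N / 5\<close>, whose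
  uniform measure is at most of order \<open>N (3 / 4)\<^bsup>N / 2\<^esup>\<close>.  By Gibbs' inequality the entropy per
  coordinate is asymptotically at least \<open>ln (5 / 4) / 2\<close>, which exceeds the value
  \<open>ln 2 / 2 - 1 / 4\<close> of the relative entropy of the limit.
\<close>

text \<open>The weight exp(- x^2) and the exponent p = N are matched to the radius. The tilted
  coordinate has mean square (N + 1) / 2 and each of the N - 1 others has mean square 1 / 2, so
  |x|^2 has mean exactly N and the projection needs no further normalisation. One coordinate thus
  absorbs half of the energy; a fixed marginal rarely contains it, which is why the limit has
  variance 1/2 although the sphere has mean square 1 per coordinate.

  The uniform measure is given as a cone measure, so the independence of direction and length is
  derived from dilations alone.

  The numbers in the entropy estimate are loosely chosen. The threshold 2/5 must stay below the
  typical share 1/2. The tail base 3/4 and the gain 5/4 must satisfy (3/4) (5/4) < 1, so that the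
  union bound vanishes, and ln (5/4) / 2 must exceed ln 2 / 2 - 1/4.

  The theorem denies entropic chaoticity for every f, not just for the Gaussian limit. This is why
  the limit density is also shown to be unique up to null sets.\<close>

section \<open>Absolute moments of the Gaussian weight\<close>

text \<open>This is Gamma((p + 1) / 2); \<open>abs_moment_add2\<close> is the functional equation of
  the Gamma function.\<close>

definition abs_moment :: "nat \<Rightarrow> real" where
  "abs_moment p = (\<integral>x. exp (- x\<^sup>2) * \<bar>x\<bar> ^ p \<partial>lborel)"

definition tilted_density :: "nat \<Rightarrow> real \<Rightarrow> real" where
  "tilted_density p x = exp (- x\<^sup>2) * \<bar>x\<bar> ^ p / abs_moment p"

definition tilted :: "nat \<Rightarrow> real measure" where
  "tilted p = density lborel (\<lambda>x. ennreal (tilted_density p x))"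

lemma abs_moment_even_odd:
  shows "has_bochner_integral lborel (\<lambda>x::real. exp (- x\<^sup>2) * \<bar>x\<bar> ^ (2 * k))
           (sqrt pi * (fact (2 * k) / (2 ^ (2 * k) * fact k)))"
    and "has_bochner_integral lborel (\<lambda>x::real. exp (- x\<^sup>2) * \<bar>x\<bar> ^ (2 * k + 1)) (fact k)"
proof -
  show "has_bochner_integral lborel (\<lambda>x::real. exp (- x\<^sup>2) * \<bar>x\<bar> ^ (2 * k))
           (sqrt pi * (fact (2 * k) / (2 ^ (2 * k) * fact k)))"
    using has_bochner_integral_even_function[OF gaussian_moment_even_pos[where k=k]]
    by (simp add: power_even_abs)
  have "has_bochner_integral lborel (\<lambda>x::real. indicator {0..} x *\<^sub>R (exp (- x\<^sup>2) * \<bar>x\<bar> ^ (2 * k + 1))) (fact k / 2)"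
    by (rule has_bochner_integral_cong[THEN iffD1, OF _ _ _ gaussian_moment_odd_pos[of k]]) auto
  from has_bochner_integral_even_function[OF this]
  show "has_bochner_integral lborel (\<lambda>x::real. exp (- x\<^sup>2) * \<bar>x\<bar> ^ (2 * k + 1)) (fact k)"
    by simp
qed

lemma has_bochner_integral_abs_moment:
  "has_bochner_integral lborel (\<lambda>x. exp (- x\<^sup>2) * \<bar>x\<bar> ^ p) (abs_moment p)"
proof -
  have "integrable lborel (\<lambda>x::real. exp (- x\<^sup>2) * \<bar>x\<bar> ^ p)"
  proof (cases "even p")
    case True
    then obtain k where p: "p = 2 * k" by (elim evenE)
    show ?thesis unfolding p using abs_moment_even_odd(1) by (rule integrable.intros)
  next
    case False
    then obtain k where p: "p = 2 * k + 1" by (elim oddE)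
    show ?thesis unfolding p using abs_moment_even_odd(2) by (rule integrable.intros)
  qed
  then show ?thesis unfolding abs_moment_def by (rule has_bochner_integral_integrable)
qed

lemma abs_moment_even: "abs_moment (2 * k) = sqrt pi * (fact (2 * k) / (2 ^ (2 * k) * fact k))"
  and abs_moment_odd: "abs_moment (2 * k + 1) = fact k"
  unfolding abs_moment_def
  by (rule has_bochner_integral_integral_eq, rule abs_moment_even_odd)+

lemma abs_moment_0 [simp]: "abs_moment 0 = sqrt pi"
  using abs_moment_even[of 0] by simp

lemma abs_moment_pos [simp]: "abs_moment p > 0"
proof (cases "even p")
  case True
  then obtain k where p: "p = 2 * k" by (elim evenE)
  show ?thesis unfolding p abs_moment_even by simp
next
  case False
  then obtain k where p: "p = 2 * k + 1" by (elim oddE)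
  show ?thesis unfolding p abs_moment_odd by simp
qed

lemma abs_moment_neq_0 [simp]: "abs_moment p \<noteq> 0"
  using abs_moment_pos[of p] by linarith

lemma abs_moment_add2: "abs_moment (p + 2) = (real p + 1) / 2 * abs_moment p"
proof (cases "even p")
  case True
  then obtain k where p: "p = 2 * k" by (elim evenE)
  have pp: "p + 2 = 2 * Suc k" by (simp add: p)
  have "fact (2 * Suc k) = 2 * (real k + 1) * (2 * real k + 1) * fact (2 * k)"
    by (simp add: algebra_simps)
  moreover have "2 ^ (2 * Suc k) * fact (Suc k) = 4 * (real k + 1) * (2 ^ (2 * k) * fact k)"
    by (simp add: algebra_simps)
  ultimately have "fact (2 * Suc k) / (2 ^ (2 * Suc k) * fact (Suc k)) =
      (2 * (real k + 1)) * ((2 * real k + 1) * fact (2 * k)) / ((2 * (real k + 1)) * (2 * (2 ^ (2 * k) * fact k)))"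
    by (simp only: mult_ac) (simp add: mult_ac)
  also have "\<dots> = (2 * real k + 1) / 2 * (fact (2 * k) / (2 ^ (2 * k) * fact k))"
    by (subst mult_divide_mult_cancel_left) auto
  finally have "fact (2 * Suc k) / (2 ^ (2 * Suc k) * fact (Suc k)) =
      (2 * real k + 1) / 2 * (fact (2 * k) / (2 ^ (2 * k) * fact k))" .
  then show ?thesis unfolding pp unfolding abs_moment_even p by simp
next
  case False
  then obtain k where p: "p = 2 * k + 1" by (elim oddE)
  have "p + 2 = 2 * Suc k + 1" by (simp add: p)
  then have "abs_moment (p + 2) = fact (Suc k)"
    using abs_moment_odd[of "Suc k"] by simp
  then show ?thesis unfolding p abs_moment_odd by (simp add: field_simps)
qed

lemma tilted_density_nonneg [simp]: "tilted_density p x \<ge> 0"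
  unfolding tilted_density_def using abs_moment_pos[of p] by (simp add: less_imp_le)

lemma tilted_density_measurable [measurable]: "tilted_density p \<in> borel_measurable borel"
  unfolding tilted_density_def by measurable

lemma tilted_density_0: "tilted_density 0 x = exp (- x\<^sup>2) / sqrt pi"
  by (simp add: tilted_density_def)

lemma tilted_density_integral: "has_bochner_integral lborel (tilted_density p) 1"
proof -
  have "has_bochner_integral lborel (\<lambda>x. exp (- x\<^sup>2) * \<bar>x\<bar> ^ p / abs_moment p) (abs_moment p / abs_moment p)"
    by (intro has_bochner_integral_divide_zero has_bochner_integral_abs_moment)
  also have "abs_moment p / abs_moment p = 1"
    using abs_moment_pos[of p] by simp
  finally show ?thesis unfolding tilted_density_def .
qed

lemma sets_tilted [measurable_cong, simp]: "sets (tilted p) = sets borel"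
  and space_tilted [simp]: "space (tilted p) = UNIV"
  by (simp_all add: tilted_def)

lemma prob_space_tilted: "prob_space (tilted p)"
proof
  have "emeasure (tilted p) (space (tilted p)) = (\<integral>\<^sup>+x. ennreal (tilted_density p x) \<partial>lborel)"
    by (simp add: tilted_def emeasure_density)
  also have "\<dots> = ennreal 1"
    using tilted_density_integral[of p] by (intro nn_integral_eq_integral[THEN trans])
      (auto simp: has_bochner_integral_iff)
  finally show "emeasure (tilted p) (space (tilted p)) = 1" by simp
qed

lemma has_bochner_integral_tilted_power:
  "has_bochner_integral (tilted p) (\<lambda>x. \<bar>x\<bar> ^ q) (abs_moment (p + q) / abs_moment p)"
  unfolding tilted_def
proof (rule has_bochner_integral_density)
  have "has_bochner_integral lborel (\<lambda>x. exp (- x\<^sup>2) * \<bar>x\<bar> ^ (p + q) / abs_moment p) (abs_moment (p + q) / abs_moment p)"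
    by (intro has_bochner_integral_divide_zero has_bochner_integral_abs_moment)
  then show "has_bochner_integral lborel (\<lambda>x. tilted_density p x *\<^sub>R \<bar>x\<bar> ^ q) (abs_moment (p + q) / abs_moment p)"
    by (simp add: tilted_density_def power_add mult_ac)
qed auto

lemma (in prob_space) has_bochner_integral_const:
  "has_bochner_integral M (\<lambda>x. c) (c :: real)"
  by (simp add: has_bochner_integral_iff prob_space)

lemma tilted_square:
  "has_bochner_integral (tilted p) (\<lambda>x. x\<^sup>2) ((real p + 1) / 2)"
  using has_bochner_integral_tilted_power[of p 2] unfolding abs_moment_add2 by simp

text \<open>Under \<open>tilted p\<close> the variable x^2 is Gamma distributed with shape (p + 1) /
  2 and scale 1, so its variance equals its mean. The fourth moment comes from two steps of the
  recursion.\<close>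

lemma tilted_square_centered:
  "has_bochner_integral (tilted p) (\<lambda>x. (x\<^sup>2 - (real p + 1) / 2)\<^sup>2) ((real p + 1) / 2)"
proof -
  interpret prob_space "tilted p" by (rule prob_space_tilted)
  define a where "a = (real p + 1) / 2"
  have "p + 4 = (p + 2) + 2" by simp
  then have "abs_moment (p + 4) = (a + 1) * a * abs_moment p"
    by (simp only: abs_moment_add2) (simp add: a_def field_simps)
  then have "abs_moment (p + 4) / abs_moment p = (a + 1) * a" by simp
  then have 4: "has_bochner_integral (tilted p) (\<lambda>x. x ^ 4) ((a + 1) * a)"
    using has_bochner_integral_tilted_power[of p 4] by simp
  have "has_bochner_integral (tilted p) (\<lambda>x. x ^ 4 - 2 * a * x\<^sup>2 + a\<^sup>2) ((a + 1) * a - 2 * a * a + a\<^sup>2)"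
    using tilted_square[of p] has_bochner_integral_const[of "a\<^sup>2"]
    unfolding a_def[symmetric]
    by (intro has_bochner_integral_add has_bochner_integral_diff has_bochner_integral_mult_right 4)
       (simp_all add: prob_space)
  moreover have "(\<lambda>x. x ^ 4 - 2 * a * x\<^sup>2 + a\<^sup>2) = (\<lambda>x. (x\<^sup>2 - a)\<^sup>2)"
    by (auto simp: power2_eq_square power4_eq_xxxx algebra_simps)
  moreover have "(a + 1) * a - 2 * a * a + a\<^sup>2 = a"
    by (simp add: power2_eq_square algebra_simps)
  ultimately show ?thesis unfolding a_def[symmetric] by (simp only:)
qed

text \<open>Independence removes the mixed terms: after expanding the square, every off-diagonal
  product contains a factor of mean zero.\<close>

lemma product_second_moment:
  fixes M :: "'i \<Rightarrow> 'a measure" and g :: "'i \<Rightarrow> 'a \<Rightarrow> real"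
  assumes "finite J" and prob: "\<And>i. prob_space (M i)"
    and int1: "\<And>i. i \<in> J \<Longrightarrow> has_bochner_integral (M i) (g i) 0"
    and int2: "\<And>i. i \<in> J \<Longrightarrow> has_bochner_integral (M i) (\<lambda>x. (g i x)\<^sup>2) (V i)"
  shows "has_bochner_integral (Pi\<^sub>M J M) (\<lambda>x. (\<Sum>i\<in>J. g i (x i))\<^sup>2) (\<Sum>i\<in>J. V i)"
proof -
  interpret product_prob_space M J
    using prob by (simp add: product_prob_space_def product_prob_space_axioms_def product_sigma_finite_def prob_space_imp_sigma_finite)
  have pair: "has_bochner_integral (Pi\<^sub>M J M) (\<lambda>x. g i (x i) * g l (x l)) (if i = l then V i else 0)"
    if il: "i \<in> J" "l \<in> J" for i l
  proof -
    \<comment> \<open>Padding the pair with factors 1 turns it into a product over all of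
      \<open>J\<close>, so that the cases i = l and i \<noteq> l come from the same product
      formula.\<close>
    define f where "f m y = (if m = i then g i y else 1) * (if m = l then g l y else 1)" for m y
    have f: "has_bochner_integral (M m) (f m)
        (if m = i \<and> m = l then V m else if m = i \<or> m = l then 0 else 1)" if m: "m \<in> J" for m
    proof -
      show ?thesis
        using int1[OF m] int2[OF m] prob_space.has_bochner_integral_const[OF prob, of m 1]
        by (auto simp: f_def[abs_def] power2_eq_square prob_space)
    qed
    then have "has_bochner_integral (Pi\<^sub>M J M) (\<lambda>x. \<Prod>m\<in>J. f m (x m))
        (\<Prod>m\<in>J. if m = i \<and> m = l then V m else if m = i \<or> m = l then 0 else 1)"
      using assms(1) by (auto simp: has_bochner_integral_iff product_integral_prod intro!: product_integrable_prod prod.cong)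
    moreover have "(\<Prod>m\<in>J. f m (x m)) = g i (x i) * g l (x l)" for x
      using assms(1) il by (simp add: f_def prod.distrib prod.delta)
    moreover have "(\<Prod>m\<in>J. if m = i \<and> m = l then V m else if m = i \<or> m = l then 0 else 1) = (if i = l then V i else 0)"
      using assms(1) il by (auto intro!: prod_zero simp: prod.delta cong: if_cong)
    ultimately show ?thesis by simp
  qed
  have "has_bochner_integral (Pi\<^sub>M J M) (\<lambda>x. \<Sum>i\<in>J. \<Sum>l\<in>J. g i (x i) * g l (x l)) (\<Sum>i\<in>J. \<Sum>l\<in>J. if i = l then V i else 0)"
    by (intro has_bochner_integral_sum pair)
  then show ?thesis
    using assms(1) by (simp add: power2_eq_square sum_product)
qed

section \<open>Polar decomposition\<close>

definition sqnorm :: "'i set \<Rightarrow> ('i \<Rightarrow> real) \<Rightarrow> real" where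
  "sqnorm J x = (\<Sum>i\<in>J. (x i)\<^sup>2)"

lemma sqnorm_nonneg [simp]: "0 \<le> sqnorm J x"
  unfolding sqnorm_def by (intro sum_nonneg) auto

lemma sqnorm_measurable [measurable]: "sqnorm J \<in> borel_measurable (Pi\<^sub>M J (\<lambda>_. borel))"
  unfolding sqnorm_def by measurable

lemma sets_PiM_lborel [measurable_cong]: "sets (Pi\<^sub>M J (\<lambda>_. lborel :: real measure)) = sets (Pi\<^sub>M J (\<lambda>_. borel))"
  by (rule sets_PiM_cong) auto

lemma space_PiM_lborel: "space (Pi\<^sub>M J (\<lambda>_. lborel :: real measure)) = J \<rightarrow>\<^sub>E UNIV"
  by (simp add: space_PiM)

lemma radial_projection_measurable [measurable]:
  "radial_projection N \<in> Pi\<^sub>M {..<N} (\<lambda>_. borel) \<rightarrow>\<^sub>M Pi\<^sub>M {..<N} (\<lambda>_. borel)"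
  unfolding radial_projection_def by measurable

section \<open>Dilations of Lebesgue measure\<close>

lemma PiM_lborel_scale:
  assumes "finite J" "c > 0"
  shows "density (distr (Pi\<^sub>M J (\<lambda>_. lborel)) (Pi\<^sub>M J (\<lambda>_. lborel)) (\<lambda>x. \<lambda>i\<in>J. c * x i))
           (\<lambda>_. ennreal (c ^ card J)) = (Pi\<^sub>M J (\<lambda>_. lborel :: real measure))"
proof -
  interpret product_sigma_finite "\<lambda>_. lborel :: real measure" ..
  have 1: "ennreal c * emeasure lborel ((\<lambda>x. c * x) -` A) = emeasure lborel A"
    if A: "A \<in> sets borel" for A :: "real set"
  proof -
    have "emeasure lborel A = emeasure (density (distr lborel borel (\<lambda>x. 0 + c * x)) (\<lambda>_. ennreal \<bar>c\<bar>)) A"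
      using lborel_real_affine[of c 0] assms(2) by simp
    also have "\<dots> = ennreal c * emeasure lborel ((\<lambda>x. c * x) -` A)"
      using A assms(2) by (simp add: emeasure_density_const emeasure_distr)
    finally show ?thesis ..
  qed
  show ?thesis
  proof (rule PiM_eqI)
    fix A :: "'a \<Rightarrow> real set" assume A: "\<And>i. i \<in> J \<Longrightarrow> A i \<in> sets lborel"
    then have A': "\<And>i. i \<in> J \<Longrightarrow> A i \<in> sets borel" by simp
    have PA: "Pi\<^sub>E J A \<in> sets (Pi\<^sub>M J (\<lambda>_. lborel))"
      using A by (intro sets_PiM_I_finite assms)
    have vim: "(\<lambda>x. c * x) -` A i \<in> sets lborel" if "i \<in> J" for i
    proof -
      have "(\<lambda>x. c * x) -` A i \<inter> space borel \<in> sets borel"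
        by (rule measurable_sets[OF _ A'[OF that]]) measurable
      then show ?thesis by simp
    qed
    have e: "emeasure (Pi\<^sub>M J (\<lambda>_. lborel)) (Pi\<^sub>E J (\<lambda>i. (\<lambda>x. c * x) -` A i)) =
        (\<Prod>i\<in>J. emeasure lborel ((\<lambda>x. c * x) -` A i))"
      by (rule emeasure_PiM) (use vim assms in auto)
    have "(\<lambda>x. \<lambda>i\<in>J. c * x i) -` Pi\<^sub>E J A \<inter> space (Pi\<^sub>M J (\<lambda>_. lborel)) = Pi\<^sub>E J (\<lambda>i. (\<lambda>x. c * x) -` A i)"
      by (auto simp: space_PiM PiE_iff)
    then have "emeasure (density (distr (Pi\<^sub>M J (\<lambda>_. lborel)) (Pi\<^sub>M J (\<lambda>_. lborel)) (\<lambda>x. \<lambda>i\<in>J. c * x i))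
        (\<lambda>_. ennreal (c ^ card J))) (Pi\<^sub>E J A) = ennreal (c ^ card J) * (\<Prod>i\<in>J. emeasure lborel ((\<lambda>x. c * x) -` A i))"
      using PA by (simp add: emeasure_density_const emeasure_distr e)
    also have "ennreal (c ^ card J) * (\<Prod>i\<in>J. emeasure lborel ((\<lambda>x. c * x) -` A i)) =
        (\<Prod>i\<in>J. ennreal c * emeasure lborel ((\<lambda>x. c * x) -` A i))"
      using assms(2) by (simp add: prod.distrib ennreal_power)
    also have "\<dots> = (\<Prod>i\<in>J. emeasure lborel (A i))"
      by (intro prod.cong 1 A') auto
    finally show "emeasure (density (distr (Pi\<^sub>M J (\<lambda>_. lborel)) (Pi\<^sub>M J (\<lambda>_. lborel)) (\<lambda>x. \<lambda>i\<in>J. c * x i))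
        (\<lambda>_. ennreal (c ^ card J))) (Pi\<^sub>E J A) = (\<Prod>i\<in>J. emeasure lborel (A i))" .
  qed (use assms in auto)
qed

lemma nn_integral_PiM_lborel_scale:
  assumes "finite J" "c > 0" and [measurable]: "f \<in> borel_measurable (Pi\<^sub>M J (\<lambda>_. borel))"
  shows "(\<integral>\<^sup>+x. f x \<partial>Pi\<^sub>M J (\<lambda>_. lborel :: real measure)) =
         ennreal (c ^ card J) * (\<integral>\<^sup>+x. f (\<lambda>i\<in>J. c * x i) \<partial>Pi\<^sub>M J (\<lambda>_. lborel))"
  by (subst PiM_lborel_scale[OF assms(1,2), symmetric])
     (simp add: nn_integral_density nn_integral_distr nn_integral_cmult)

lemma sqnorm_scale: "sqnorm J (\<lambda>i\<in>J. c * x i) = c\<^sup>2 * sqnorm J x"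
  by (simp add: sqnorm_def power_mult_distrib sum_distrib_left cong: sum.cong)

lemma radial_projection_scale:
  assumes "c > 0"
  shows "radial_projection N (\<lambda>i\<in>{..<N}. c * x i) = radial_projection N x"
proof -
  have "(\<Sum>j<N. ((\<lambda>i\<in>{..<N}. c * x i) j)\<^sup>2) = c\<^sup>2 * (\<Sum>j<N. (x j)\<^sup>2)"
    using sqnorm_scale[of "{..<N}" c x] by (simp add: sqnorm_def)
  then show ?thesis
    using assms unfolding radial_projection_def
    by (intro restrict_ext) (simp add: real_sqrt_mult)
qed

lemma punctured_ball_sets [measurable]: "punctured_ball N \<in> sets (Pi\<^sub>M {..<N} (\<lambda>_. borel))"
proof -
  have "punctured_ball N = {x \<in> space (Pi\<^sub>M {..<N} (\<lambda>_. borel)). 0 < (\<Sum>i<N. (x i)\<^sup>2) \<and> (\<Sum>i<N. (x i)\<^sup>2) \<le> real N}"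
    unfolding punctured_ball_def by (simp add: space_PiM)
  also have "\<dots> \<in> sets (Pi\<^sub>M {..<N} (\<lambda>_. borel))" by measurable
  finally show ?thesis .
qed

section \<open>The cone measure in terms of Lebesgue integrals\<close>

lemma sets_sphere_measure [measurable_cong]:
  "sets (sphere_measure N) = sets (restrict_space (Pi\<^sub>M {..<N} (\<lambda>_. borel)) (kac_sphere N))"
  by (simp add: sphere_measure_def)

lemma space_sphere_measure: "space (sphere_measure N) = kac_sphere N"
  by (auto simp: sphere_measure_def space_restrict_space space_PiM kac_sphere_def)

lemma measurable_sphere:
  "f \<in> Pi\<^sub>M {..<N} (\<lambda>_. borel) \<rightarrow>\<^sub>M M \<Longrightarrow> f \<in> sphere_measure N \<rightarrow>\<^sub>M M"
  by (subst measurable_cong_sets[OF sets_sphere_measure refl]) (rule measurable_restrict_space1)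

text \<open>Here \<open>g\<close> is a function on the whole product space, not on the sphere, so
  that later measurability questions all concern one product sigma-algebra.\<close>

lemma nn_integral_sphere_measure:
  assumes N: "N \<ge> 1" and [measurable]: "g \<in> borel_measurable (Pi\<^sub>M {..<N} (\<lambda>_. borel))"
  shows "(\<integral>\<^sup>+v. g v \<partial>sphere_measure N) =
    (\<integral>\<^sup>+x. g (radial_projection N x) * indicator (punctured_ball N) x \<partial>Pi\<^sub>M {..<N} (\<lambda>_. lborel))
      / emeasure (Pi\<^sub>M {..<N} (\<lambda>_. lborel)) (punctured_ball N)"
proof -
  let ?L = "Pi\<^sub>M {..<N} (\<lambda>_. lborel :: real measure)" and ?B = "punctured_ball N"
  let ?R = "restrict_space ?L ?B" and ?\<pi> = "radial_projection N"
  have B[measurable]: "?B \<in> sets ?L" by measurable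
  have spR: "space ?R = ?B"
    by (auto simp: space_restrict_space space_PiM punctured_ball_def)
  have "?\<pi> \<in> ?R \<rightarrow>\<^sub>M restrict_space (Pi\<^sub>M {..<N} (\<lambda>_. borel)) (kac_sphere N)"
    by (intro measurable_restrict_space2 measurable_restrict_space1)
       (use N in \<open>auto simp: space_restrict_space radial_projection_in_sphere\<close>)
  then have "(\<integral>\<^sup>+v. g v \<partial>sphere_measure N) = (\<integral>\<^sup>+x. g (?\<pi> x) \<partial>uniform_measure ?R ?B)"
    unfolding sphere_measure_def
    by (intro nn_integral_distr) (auto intro!: measurable_restrict_space1)
  also have "\<dots> = (\<integral>\<^sup>+x. g (?\<pi> x) * indicator ?B x \<partial>?R) / emeasure ?R ?B"
    by (intro nn_integral_uniform_measure)
       (auto intro!: measurable_restrict_space1 simp: sets_restrict_space)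
  also have "emeasure ?R ?B = emeasure ?L ?B"
    using B by (intro emeasure_restrict_space) auto
  also have "(\<integral>\<^sup>+x. g (?\<pi> x) * indicator ?B x \<partial>?R) = (\<integral>\<^sup>+x. g (?\<pi> x) * indicator ?B x \<partial>?L)"
    using B by (subst nn_integral_restrict_space)
      (auto intro!: nn_integral_cong split: split_indicator)
  finally show ?thesis .
qed

text \<open>Read off from the total mass of the sphere measure, which is \<open>?v / ?v\<close>: in
  \<open>ennreal\<close> this quotient is 0 instead of 1 if the volume is 0 or infinite.\<close>

lemma emeasure_punctured_ball:
  assumes "N \<ge> 1"
  shows "emeasure (Pi\<^sub>M {..<N} (\<lambda>_. lborel)) (punctured_ball N) \<noteq> 0"
    and "emeasure (Pi\<^sub>M {..<N} (\<lambda>_. lborel)) (punctured_ball N) \<noteq> \<infinity>"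
proof -
  let ?v = "emeasure (Pi\<^sub>M {..<N} (\<lambda>_. lborel)) (punctured_ball N)"
  interpret prob_space "sphere_measure N" by (rule prob_space_sphere_measure[OF assms])
  have "?v / ?v = (\<integral>\<^sup>+v. 1 \<partial>sphere_measure N)"
    using nn_integral_sphere_measure[OF assms, of "\<lambda>_. 1"] by (simp add: sets_PiM_lborel)
  then have "?v / ?v = 1" by (simp add: emeasure_space_1)
  then show "?v \<noteq> 0" "?v \<noteq> \<infinity>" by auto
qed

text \<open>
  By homogeneity both sides depend on a threshold \<open>t\<close> for \<open>|x|\<^sup>2\<close> only through \<open>t\<^bsup>N / 2\<^esup>\<close>, so the
  distributions of \<open>|x|\<^sup>2\<close> with and without the weight \<open>g\<close> are proportional.  The proof uses
  \<open>- |x|\<^sup>2\<close> because then the upper half lines have finite measure.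
\<close>

lemma nn_integral_polar:
  assumes N: "N \<ge> 1" and g [measurable]: "g \<in> borel_measurable (Pi\<^sub>M {..<N} (\<lambda>_. borel))"
    and bound: "\<And>x. g (radial_projection N x) \<le> ennreal K"
    and h [measurable]: "h \<in> borel_measurable borel"
  shows "(\<integral>\<^sup>+x. g (radial_projection N x) * h (sqnorm {..<N} x) \<partial>Pi\<^sub>M {..<N} (\<lambda>_. lborel)) =
         (\<integral>\<^sup>+v. g v \<partial>sphere_measure N) * (\<integral>\<^sup>+x. h (sqnorm {..<N} x) \<partial>Pi\<^sub>M {..<N} (\<lambda>_. lborel))"
proof -
  let ?L = "Pi\<^sub>M {..<N} (\<lambda>_. lborel :: real measure)"
  let ?\<pi> = "radial_projection N" and ?q = "sqnorm {..<N}" and ?B = "punctured_ball N"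
  have ball: "emeasure ?L {x \<in> space ?L. ?q x < 1} < \<infinity>"
  proof -
    have "emeasure ?L {x \<in> space ?L. ?q x < 1} \<le>
        emeasure ?L ({f. sqrt (\<Sum>i<N. (f i)\<^sup>2) \<le> 1} \<inter> space ?L)"
    proof (rule emeasure_mono)
      have "{f. sqrt (\<Sum>i<N. (f i)\<^sup>2) \<le> 1} \<inter> space ?L = {f \<in> space ?L. sqrt (\<Sum>i<N. (f i)\<^sup>2) \<le> 1}" by auto
      also have "\<dots> \<in> sets ?L" by measurable
      finally show "{f. sqrt (\<Sum>i<N. (f i)\<^sup>2) \<le> 1} \<inter> space ?L \<in> sets ?L" .
    qed (auto simp: sqnorm_def)
    also have "\<dots> < \<infinity>"
      by (subst emeasure_cball_aux) auto
    finally show ?thesis .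
  qed
  define a where "a u = (\<integral>\<^sup>+x. u (?\<pi> x) * indicator {..<1} (?q x) \<partial>?L)" for u
  define \<nu> where "\<nu> u = distr (density ?L (\<lambda>x. u (?\<pi> x))) borel (\<lambda>x. - ?q x)" for u
  have a_fin: "a u < \<infinity>" if [measurable]: "u \<in> borel_measurable (Pi\<^sub>M {..<N} (\<lambda>_. borel))"
    and u: "\<And>x. u (?\<pi> x) \<le> ennreal C" for u C
  proof -
    have "a u \<le> (\<integral>\<^sup>+x. ennreal C * indicator {x \<in> space ?L. ?q x < 1} x \<partial>?L)"
      unfolding a_def by (intro nn_integral_mono) (auto simp: u split: split_indicator)
    also have "\<dots> = ennreal C * emeasure ?L {x \<in> space ?L. ?q x < 1}"
      by (intro nn_integral_cmult_indicator) measurable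
    also have "\<dots> < \<infinity>" using ball by (auto simp: ennreal_mult_less_top)
    finally show ?thesis .
  qed
  have \<nu>: "emeasure (\<nu> u) {y<..} = (if y < 0 then ennreal (sqrt (- y) ^ N) * a u else 0)"
    if [measurable]: "u \<in> borel_measurable (Pi\<^sub>M {..<N} (\<lambda>_. borel))" for u y
  proof -
    have "emeasure (\<nu> u) {y<..} = (\<integral>\<^sup>+x. indicator {y<..} x \<partial>\<nu> u)"
      by (subst nn_integral_indicator) (auto simp: \<nu>_def)
    also have "\<dots> = (\<integral>\<^sup>+x. u (?\<pi> x) * indicator {..<-y} (?q x) \<partial>?L)"
      unfolding \<nu>_def
      by (subst nn_integral_distr, measurable, subst nn_integral_density)
         (auto intro!: nn_integral_cong split: split_indicator)
    also have "\<dots> = (if y < 0 then ennreal (sqrt (- y) ^ N) * a u else 0)"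
    proof (cases "y < 0")
      case True
      then have s: "sqrt (- y) > 0" by simp
      have "(\<integral>\<^sup>+x. u (?\<pi> x) * indicator {..<-y} (?q x) \<partial>?L) =
         ennreal (sqrt (- y) ^ card {..<N}) *
         (\<integral>\<^sup>+x. u (?\<pi> (\<lambda>i\<in>{..<N}. sqrt (- y) * x i)) * indicator {..<-y} (?q (\<lambda>i\<in>{..<N}. sqrt (- y) * x i)) \<partial>?L)"
        by (intro nn_integral_PiM_lborel_scale s) auto
      also have "\<dots> = ennreal (sqrt (- y) ^ N) * a u"
        unfolding radial_projection_scale[OF s] sqnorm_scale a_def
        using True by (intro arg_cong2[where f="(*)"] nn_integral_cong) (auto split: split_indicator simp: mult_less_cancel_left)
      finally show ?thesis using True by simp
    next
      case False
      then have "?q x \<ge> - y" for x using sqnorm_nonneg[of "{..<N}" x] by linarith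
      then have "indicator {..<-y} (?q x) = (0::ennreal)" for x
        by (auto split: split_indicator simp: not_less)
      then show ?thesis using False by simp
    qed
    finally show ?thesis .
  qed
  have g_fin: "a g < \<infinity>" by (rule a_fin[OF g bound])
  have one_fin: "a (\<lambda>_. 1) < \<infinity>" by (rule a_fin[where C=1]) auto
  \<comment> \<open>On {y<..} with y < 0 both sides equal sqrt (- y) ^ N times the product of the
    two values of \<open>a\<close>. The proportionality is stated in cross-multiplied form because
    \<open>a (\<lambda>_. 1)\<close> is shown to be nonzero only below.\<close>
  have "density (\<nu> g) (\<lambda>_. a (\<lambda>_. 1)) = density (\<nu> (\<lambda>_. 1)) (\<lambda>_. a g)"
  proof (rule measure_eqI_lessThan)
    fix y
    show "emeasure (density (\<nu> g) (\<lambda>_. a (\<lambda>_. 1))) {y<..} < \<infinity>"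
      using g_fin one_fin
      by (subst emeasure_density_const) (auto simp: \<nu> ennreal_mult_less_top, auto simp: \<nu>_def)
    show "emeasure (density (\<nu> g) (\<lambda>_. a (\<lambda>_. 1))) {y<..} = emeasure (density (\<nu> (\<lambda>_. 1)) (\<lambda>_. a g)) {y<..}"
      by (subst (1 2) emeasure_density_const) (auto simp: \<nu> mult_ac, auto simp: \<nu>_def)
  qed (auto simp: \<nu>_def)
  note eq = this
  have key: "a (\<lambda>_. 1) * (\<integral>\<^sup>+x. g (?\<pi> x) * k (?q x) \<partial>?L) = a g * (\<integral>\<^sup>+x. k (?q x) \<partial>?L)"
    if [measurable]: "k \<in> borel_measurable borel" for k
    using arg_cong[OF eq, of "\<lambda>M. \<integral>\<^sup>+s. k (- s) \<partial>M"]
    unfolding \<nu>_def by (simp add: nn_integral_density nn_integral_distr nn_integral_cmult)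
  have B: "indicator ?B x = (indicator {0<..real N} (?q x) :: ennreal)" if "x \<in> space ?L" for x
    using that by (auto simp: punctured_ball_def sqnorm_def space_PiM split: split_indicator)
  have Bv: "(\<integral>\<^sup>+x. indicator {0<..real N} (?q x) \<partial>?L) = emeasure ?L ?B"
  proof -
    have "(\<integral>\<^sup>+x. indicator {0<..real N} (?q x) \<partial>?L) = (\<integral>\<^sup>+x. indicator ?B x \<partial>?L)"
      by (intro nn_integral_cong) (simp add: B)
    then show ?thesis by (simp add: sets_PiM_lborel)
  qed
  \<comment> \<open>If the unit ball were null, then by dilation so would be the ball |x|^2 < N + 1,
    which contains \<open>punctured_ball N\<close>.\<close>
  have a1: "a (\<lambda>_. 1) \<noteq> 0"
  proof
    assume "a (\<lambda>_. 1) = 0"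
    then have "emeasure (\<nu> (\<lambda>_. 1)) {- (real N + 1)<..} = 0" by (simp add: \<nu>)
    also have "emeasure (\<nu> (\<lambda>_. 1)) {- (real N + 1)<..} = emeasure ?L {x \<in> space ?L. ?q x < real N + 1}"
      unfolding \<nu>_def density_1
      by (subst emeasure_distr) (auto intro!: arg_cong2[where f=emeasure])
    finally have "emeasure ?L {x \<in> space ?L. ?q x < real N + 1} = 0" .
    moreover have "emeasure ?L ?B \<le> emeasure ?L {x \<in> space ?L. ?q x < real N + 1}"
    proof (rule emeasure_mono)
      show "?B \<subseteq> {x \<in> space ?L. ?q x < real N + 1}"
      proof
        fix x assume "x \<in> ?B"
        then have "x \<in> space ?L" and "?q x \<le> real N"
          unfolding punctured_ball_def sqnorm_def space_PiM_lborel by (simp_all only: mem_Collect_eq)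
        then show "x \<in> {x \<in> space ?L. ?q x < real N + 1}" by simp
      qed
    qed measurable
    ultimately show False using emeasure_punctured_ball(1)[OF N] by simp
  qed
  define c where "c = a g / a (\<lambda>_. 1)"
  have key': "(\<integral>\<^sup>+x. g (?\<pi> x) * k (?q x) \<partial>?L) = c * (\<integral>\<^sup>+x. k (?q x) \<partial>?L)"
    if k: "k \<in> borel_measurable borel" for k
  proof -
    have "(\<integral>\<^sup>+x. g (?\<pi> x) * k (?q x) \<partial>?L) = (a (\<lambda>_. 1) * (\<integral>\<^sup>+x. g (?\<pi> x) * k (?q x) \<partial>?L)) / a (\<lambda>_. 1)"
      using a1 one_fin by (subst mult.commute, subst mult_divide_eq_ennreal) auto
    also have "\<dots> = c * (\<integral>\<^sup>+x. k (?q x) \<partial>?L)"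
      unfolding key[OF k] c_def by (simp add: divide_ennreal_def mult_ac)
    finally show ?thesis .
  qed
  \<comment> \<open>Choosing for \<open>k\<close> the indicator of {0<..N} recovers the cone measure
    and so identifies the constant \<open>c\<close> as the integral over the sphere.\<close>
  have "(\<integral>\<^sup>+v. g v \<partial>sphere_measure N) = (\<integral>\<^sup>+x. g (?\<pi> x) * indicator {0<..real N} (?q x) \<partial>?L) / emeasure ?L ?B"
    unfolding nn_integral_sphere_measure[OF N g]
    by (intro arg_cong2[where f="(/)"] nn_integral_cong refl) (simp add: B)
  also have "\<dots> = c * emeasure ?L ?B / emeasure ?L ?B"
    by (subst key') (auto simp: Bv)
  also have "\<dots> = c"
    using emeasure_punctured_ball[OF N] by (simp add: mult_divide_eq_ennreal)
  finally show ?thesis using key'[OF h] by simp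
qed

section \<open>Tilted product measures\<close>

text \<open>For p = 0 this is the plain Gaussian product, whose radial projection is the uniform
  measure; \<open>sphere_coordinate_tail\<close> uses it in that role.\<close>

definition tilted_product :: "nat set \<Rightarrow> nat \<Rightarrow> nat \<Rightarrow> (nat \<Rightarrow> real) measure" where
  "tilted_product J p j = Pi\<^sub>M J (\<lambda>i. tilted (if i = j then p else 0))"

lemma sets_tilted_product [measurable_cong]:
  "sets (tilted_product J p j) = sets (Pi\<^sub>M J (\<lambda>_. borel))"
  unfolding tilted_product_def by (rule sets_PiM_cong) auto

lemma product_prob_space_tilted: "product_prob_space (\<lambda>i. tilted (p i))"
  by (simp add: product_prob_space_def product_prob_space_axioms_def product_sigma_finite_def
      prob_space_tilted prob_space_imp_sigma_finite)

lemma prob_space_tilted_product: "prob_space (tilted_product J p j)"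
proof -
  interpret product_prob_space "\<lambda>i. tilted (if i = j then p else 0)" J
    by (rule product_prob_space_tilted)
  show ?thesis unfolding tilted_product_def by (rule prob_space_axioms)
qed

lemma PiM_tilted_eq_density:
  assumes "finite J"
  shows "Pi\<^sub>M J (\<lambda>i. tilted (p i)) =
    density (Pi\<^sub>M J (\<lambda>_. lborel)) (\<lambda>x. ennreal (\<Prod>i\<in>J. tilted_density (p i) (x i)))"
proof -
  interpret L: product_sigma_finite "\<lambda>_::'a. lborel :: real measure" ..
  interpret product_prob_space "\<lambda>i. tilted (p i)" J by (rule product_prob_space_tilted)
  have "density (Pi\<^sub>M J (\<lambda>_. lborel)) (\<lambda>x. ennreal (\<Prod>i\<in>J. tilted_density (p i) (x i))) = Pi\<^sub>M J (\<lambda>i. tilted (p i))"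
  proof (rule PiM_eqI)
    show "sets (density (Pi\<^sub>M J (\<lambda>_. lborel)) (\<lambda>x. ennreal (\<Prod>i\<in>J. tilted_density (p i) (x i)))) = sets (Pi\<^sub>M J (\<lambda>i. tilted (p i)))"
      by (simp cong: sets_PiM_cong)
    fix A :: "'a \<Rightarrow> real set" assume "\<And>i. i \<in> J \<Longrightarrow> A i \<in> sets (tilted (p i))"
    then have A: "\<And>i. i \<in> J \<Longrightarrow> A i \<in> sets borel" by simp
    have PA: "Pi\<^sub>E J A \<in> sets (Pi\<^sub>M J (\<lambda>_. lborel))"
      using A assms by (intro sets_PiM_I_finite) auto
    have "emeasure (density (Pi\<^sub>M J (\<lambda>_. lborel)) (\<lambda>x. ennreal (\<Prod>i\<in>J. tilted_density (p i) (x i)))) (Pi\<^sub>E J A) =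
        (\<integral>\<^sup>+x. ennreal (\<Prod>i\<in>J. tilted_density (p i) (x i)) * indicator (Pi\<^sub>E J A) x \<partial>Pi\<^sub>M J (\<lambda>_. lborel))"
      using PA by (intro emeasure_density) auto
    also have "\<dots> = (\<integral>\<^sup>+x. (\<Prod>i\<in>J. ennreal (tilted_density (p i) (x i)) * indicator (A i) (x i)) \<partial>Pi\<^sub>M J (\<lambda>_. lborel))"
    proof (rule nn_integral_cong)
      fix x assume x: "x \<in> space (Pi\<^sub>M J (\<lambda>_. lborel :: real measure))"
      have "indicator (Pi\<^sub>E J A) x = (\<Prod>i\<in>J. indicator (A i) (x i) :: ennreal)"
        using x assms by (auto simp: space_PiM PiE_iff indicator_def prod_zero_iff)
      then show "ennreal (\<Prod>i\<in>J. tilted_density (p i) (x i)) * indicator (Pi\<^sub>E J A) x =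
          (\<Prod>i\<in>J. ennreal (tilted_density (p i) (x i)) * indicator (A i) (x i))"
        by (simp add: prod.distrib prod_ennreal)
    qed
    also have "\<dots> = (\<Prod>i\<in>J. \<integral>\<^sup>+x. ennreal (tilted_density (p i) x) * indicator (A i) x \<partial>lborel)"
      using A assms by (intro L.product_nn_integral_prod) auto
    also have "\<dots> = (\<Prod>i\<in>J. emeasure (tilted (p i)) (A i))"
      using A by (intro prod.cong refl) (simp add: tilted_def emeasure_density)
    finally show "emeasure (density (Pi\<^sub>M J (\<lambda>_. lborel)) (\<lambda>x. ennreal (\<Prod>i\<in>J. tilted_density (p i) (x i)))) (Pi\<^sub>E J A) =
        (\<Prod>i\<in>J. emeasure (tilted (p i)) (A i))" .
  qed fact
  then show ?thesis ..
qed

lemma prod_tilted_density_measurable: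
  "(\<lambda>x. ennreal (\<Prod>i\<in>J. tilted_density (p i) (x i))) \<in> borel_measurable (Pi\<^sub>M J (\<lambda>_. lborel))"
proof -
  have "(\<lambda>x. tilted_density (p i) (x i)) \<in> borel_measurable (Pi\<^sub>M J (\<lambda>_. lborel))" if "i \<in> J" for i
    by (rule measurable_compose[OF measurable_component_singleton[OF that]]) simp
  then show ?thesis by (intro measurable_compose[OF borel_measurable_prod measurable_ennreal])
qed

text \<open>The point of Gaussian factors: apart from |x j|^p, the joint density depends on x only
  through |x|^2.\<close>

lemma prod_tilted_density:
  assumes "finite J" "j \<in> J"
  shows "(\<Prod>i\<in>J. tilted_density (if i = j then p else 0) (x i)) =
    \<bar>x j\<bar> ^ p * exp (- sqnorm J x) / (abs_moment p * sqrt pi ^ (card J - 1))"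
proof -
  have "(\<Prod>i\<in>J. tilted_density (if i = j then p else 0) (x i)) =
      tilted_density p (x j) * (\<Prod>i\<in>J - {j}. exp (- (x i)\<^sup>2) / sqrt pi)"
    using assms by (subst prod.remove[of _ j]) (auto simp: tilted_density_0 intro!: prod.cong)
  also have "(\<Prod>i\<in>J - {j}. exp (- (x i)\<^sup>2) / sqrt pi) = exp (- (\<Sum>i\<in>J - {j}. (x i)\<^sup>2)) / sqrt pi ^ (card J - 1)"
    using assms by (simp add: prod_dividef exp_sum sum_negf[symmetric])
  also have "(\<Sum>i\<in>J - {j}. (x i)\<^sup>2) = sqnorm J x - (x j)\<^sup>2"
    using assms by (simp add: sqnorm_def sum.remove[of J j])
  finally show ?thesis
    by (simp add: tilted_density_def mult_ac exp_add[symmetric])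
qed

lemma abs_le_sqrt_sqnorm: "i \<in> J \<Longrightarrow> finite J \<Longrightarrow> \<bar>x i\<bar> \<le> sqrt (sqnorm J x)"
  unfolding sqnorm_def by (intro real_le_rsqrt) (auto intro!: member_le_sum)

lemma radial_projection_nth:
  "i < N \<Longrightarrow> radial_projection N x i = sqrt (real N) * x i / sqrt (sqnorm {..<N} x)"
  by (simp add: radial_projection_def sqnorm_def)

lemma sqnorm_pos: "sqnorm J x \<noteq> 0 \<Longrightarrow> sqnorm J x > 0"
  using sqnorm_nonneg[of J x] by linarith

lemma abs_radial_projection_le:
  assumes "i < N"
  shows "\<bar>radial_projection N x i\<bar> \<le> sqrt (real N)"
\<comment> \<open>At the origin division by zero makes all coordinates of the projection 0, so the
  bound persists; \<open>nn_integral_polar\<close> asks for a bound at every point.\<close>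
proof (cases "sqnorm {..<N} x = 0")
  case False
  then have pos: "sqrt (sqnorm {..<N} x) > 0" by (simp add: sqnorm_pos)
  have "\<bar>x i\<bar> \<le> sqrt (sqnorm {..<N} x)" using assms by (intro abs_le_sqrt_sqnorm) auto
  then have "sqrt (real N) * \<bar>x i\<bar> \<le> sqrt (real N) * sqrt (sqnorm {..<N} x)"
    by (rule mult_left_mono) simp
  then show ?thesis
    using pos assms by (simp add: radial_projection_nth abs_mult divide_le_eq)
qed (use assms in \<open>simp add: radial_projection_nth\<close>)

lemma kac_sphere_abs_le:
  assumes "v \<in> kac_sphere N" "i < N"
  shows "\<bar>v i\<bar> \<le> sqrt (real N)"
  using abs_le_sqrt_sqnorm[of i "{..<N}" v] assms by (simp add: kac_sphere_def sqnorm_def)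

text \<open>The |x j|^p factor splits as |v j|^p (|x| / sqrt N)^p, where v is the projection of x.
  The density is then a function of v times the function \<open>h\<close> of |x|^2, and
  \<open>nn_integral_polar\<close> applies. The constant is chosen before \<open>j\<close>: that it
  serves all coordinates is what later gives the summands of the power sum equal weights.\<close>

lemma nn_integral_tilted_product_radial:
  assumes N: "N \<ge> 1"
  shows "\<exists>c. \<forall>j<N. \<forall>A\<in>sets (Pi\<^sub>M {..<N} (\<lambda>_. borel)).
    (\<integral>\<^sup>+x. indicator A (radial_projection N x) \<partial>tilted_product {..<N} p j) =
    c * (\<integral>\<^sup>+v. ennreal (\<bar>v j\<bar> ^ p) * indicator A v \<partial>sphere_measure N)"
proof -
  let ?L = "Pi\<^sub>M {..<N} (\<lambda>_. lborel :: real measure)"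
  let ?\<pi> = "radial_projection N" and ?q = "sqnorm {..<N}"
  define h where "h s = ennreal ((sqrt s / sqrt (real N)) ^ p * exp (- s) / (abs_moment p * sqrt pi ^ (N - 1)))" for s
  have [measurable]: "h \<in> borel_measurable borel" unfolding h_def by measurable
  show ?thesis
  proof (intro exI[of _ "\<integral>\<^sup>+x. h (?q x) \<partial>?L"] allI impI ballI)
    fix j A assume j: "j < N" and A[measurable]: "A \<in> sets (Pi\<^sub>M {..<N} (\<lambda>_. borel :: real measure))"
    define g where "g v = ennreal (\<bar>v j\<bar> ^ p) * indicator A v" for v :: "nat \<Rightarrow> real"
    have [measurable]: "(\<lambda>v. v j) \<in> borel_measurable (Pi\<^sub>M {..<N} (\<lambda>_. borel :: real measure))"
      using j by (intro measurable_component_singleton) simp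
    have g[measurable]: "g \<in> borel_measurable (Pi\<^sub>M {..<N} (\<lambda>_. borel))"
      unfolding g_def by measurable
    have g_bound: "g (?\<pi> x) \<le> ennreal (sqrt (real N) ^ p)" for x
      using abs_radial_projection_le[OF j, of x] unfolding g_def
      by (auto split: split_indicator intro!: ennreal_leI power_mono)
    have dens: "ennreal (\<Prod>i<N. tilted_density (if i = j then p else 0) (x i)) * indicator A (?\<pi> x) =
        g (?\<pi> x) * h (?q x)" for x
    proof -
      have "\<bar>x j\<bar> = \<bar>?\<pi> x j\<bar> * (sqrt (?q x) / sqrt (real N))"
      proof (cases "?q x = 0")
        case True
        then have "\<bar>x j\<bar> = 0" using abs_le_sqrt_sqnorm[of j "{..<N}" x] j by simp
        then show ?thesis using True by simp
      next
        case False
        then have "sqrt (?q x) > 0" by (simp add: sqnorm_pos)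
        then show ?thesis using j N by (simp add: radial_projection_nth abs_mult)
      qed
      then have "\<bar>x j\<bar> ^ p = \<bar>?\<pi> x j\<bar> ^ p * (sqrt (?q x) / sqrt (real N)) ^ p"
        by (simp only: power_mult_distrib)
      then have "(\<Prod>i<N. tilted_density (if i = j then p else 0) (x i)) =
          \<bar>?\<pi> x j\<bar> ^ p * ((sqrt (?q x) / sqrt (real N)) ^ p * exp (- ?q x) / (abs_moment p * sqrt pi ^ (N - 1)))"
        using j by (subst prod_tilted_density) auto
      then have "ennreal (\<Prod>i<N. tilted_density (if i = j then p else 0) (x i)) = ennreal (\<bar>?\<pi> x j\<bar> ^ p) * h (?q x)"
        unfolding h_def by (simp only:) (rule ennreal_mult', simp)
      then show ?thesis unfolding g_def by (simp add: mult_ac)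
    qed
    have "(\<integral>\<^sup>+x. indicator A (?\<pi> x) \<partial>tilted_product {..<N} p j) =
        (\<integral>\<^sup>+x. ennreal (\<Prod>i<N. tilted_density (if i = j then p else 0) (x i)) * indicator A (?\<pi> x) \<partial>?L)"
      unfolding tilted_product_def
      by (subst PiM_tilted_eq_density, simp, rule nn_integral_density)
         (rule prod_tilted_density_measurable, measurable)
    also have "\<dots> = (\<integral>\<^sup>+v. g v \<partial>sphere_measure N) * (\<integral>\<^sup>+x. h (?q x) \<partial>?L)"
      unfolding dens by (rule nn_integral_polar[OF N g g_bound]) measurable
    finally show "(\<integral>\<^sup>+x. indicator A (?\<pi> x) \<partial>tilted_product {..<N} p j) =
        (\<integral>\<^sup>+x. h (?q x) \<partial>?L) * (\<integral>\<^sup>+v. ennreal (\<bar>v j\<bar> ^ p) * indicator A v \<partial>sphere_measure N)"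
      unfolding g_def by (simp add: mult.commute)
  qed
qed

lemma integral_tilted_product_radial:
  assumes N: "N \<ge> 1"
  obtains C where "C > 0"
    "\<And>j \<psi>. j < N \<Longrightarrow> \<psi> \<in> borel_measurable (Pi\<^sub>M {..<N} (\<lambda>_. borel)) \<Longrightarrow>
      (\<integral>x. (\<psi> (radial_projection N x) :: real) \<partial>tilted_product {..<N} p j) =
      C * (\<integral>v. \<bar>v j\<bar> ^ p * \<psi> v \<partial>sphere_measure N)"
proof -
  let ?B = "Pi\<^sub>M {..<N} (\<lambda>_. borel :: real measure)"
  let ?\<pi> = "radial_projection N" and ?\<sigma> = "sphere_measure N"
  obtain c where c: "\<And>j A. j < N \<Longrightarrow> A \<in> sets ?B \<Longrightarrow>
    (\<integral>\<^sup>+x. indicator A (?\<pi> x) \<partial>tilted_product {..<N} p j) =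
    c * (\<integral>\<^sup>+v. ennreal (\<bar>v j\<bar> ^ p) * indicator A v \<partial>?\<sigma>)"
    using nn_integral_tilted_product_radial[OF N, of p] by blast
  \<comment> \<open>Comparing total masses shows that \<open>c\<close> times some integral is 1. In
    \<open>ennreal\<close> a multiple of 0 is 0 and a multiple of infinity is 0 or infinity.\<close>
  have c_fin: "0 < c \<and> c < \<infinity>"
  proof -
    interpret prob_space "tilted_product {..<N} p 0" by (rule prob_space_tilted_product)
    have "?\<pi> x \<in> space ?B" for x by (simp add: radial_projection_def space_PiM)
    then have "(\<integral>\<^sup>+x. indicator (space ?B) (?\<pi> x) \<partial>tilted_product {..<N} p 0) = 1"
      by (simp add: emeasure_space_1)
    moreover have "(\<integral>\<^sup>+x. indicator (space ?B) (?\<pi> x) \<partial>tilted_product {..<N} p 0) =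
      c * (\<integral>\<^sup>+v. ennreal (\<bar>v 0\<bar> ^ p) * indicator (space ?B) v \<partial>?\<sigma>)"
      using N by (intro c) auto
    ultimately have "c * (\<integral>\<^sup>+v. ennreal (\<bar>v 0\<bar> ^ p) * indicator (space ?B) v \<partial>?\<sigma>) = 1"
      by simp
    then show ?thesis
      by (auto simp: less_top[symmetric] ennreal_top_mult zero_less_iff_neq_zero split: if_splits)
  qed
  define C where "C = enn2real c"
  have C: "c = ennreal C" "C > 0"
    using c_fin by (auto simp: C_def enn2real_positive_iff)
  show ?thesis
  proof (rule that[OF C(2)])
    fix j and \<psi> :: "(nat \<Rightarrow> real) \<Rightarrow> real"
    assume j: "j < N" and \<psi>[measurable]: "\<psi> \<in> borel_measurable ?B"
    have [measurable]: "(\<lambda>v. v j) \<in> borel_measurable ?B"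
      using j by (intro measurable_component_singleton) simp
    have id: "(\<lambda>v. v) \<in> ?\<sigma> \<rightarrow>\<^sub>M ?B" by (rule measurable_sphere) (rule measurable_ident_sets[OF refl])
    have \<pi>: "?\<pi> \<in> tilted_product {..<N} p j \<rightarrow>\<^sub>M ?B" by measurable
    \<comment> \<open>The identity map moves the sphere measure to the ambient product space, where
      it can be compared with the projected product. An equation between measures then transfers the
      Bochner integral of every measurable \<open>\<psi>\<close>, integrable or not.\<close>
    have eq: "distr (tilted_product {..<N} p j) ?B ?\<pi> =
        density (distr ?\<sigma> ?B (\<lambda>v. v)) (\<lambda>v. ennreal (C * \<bar>v j\<bar> ^ p))"
    proof (rule measure_eqI)
      fix A assume "A \<in> sets (distr (tilted_product {..<N} p j) ?B ?\<pi>)"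
      then have A[measurable]: "A \<in> sets ?B" by simp
      have "emeasure (distr (tilted_product {..<N} p j) ?B ?\<pi>) A = (\<integral>\<^sup>+x. indicator A x \<partial>distr (tilted_product {..<N} p j) ?B ?\<pi>)"
        by simp
      also have "\<dots> = (\<integral>\<^sup>+x. indicator A (?\<pi> x) \<partial>tilted_product {..<N} p j)"
        by (intro nn_integral_distr \<pi>) simp_all
      also have "\<dots> = c * (\<integral>\<^sup>+v. ennreal (\<bar>v j\<bar> ^ p) * indicator A v \<partial>?\<sigma>)"
        by (rule c[OF j A])
      also have "\<dots> = (\<integral>\<^sup>+v. c * (ennreal (\<bar>v j\<bar> ^ p) * indicator A v) \<partial>?\<sigma>)"
        by (rule nn_integral_cmult[symmetric]) (rule measurable_sphere, measurable)
      also have "\<dots> = (\<integral>\<^sup>+v. ennreal (C * \<bar>v j\<bar> ^ p) * indicator A v \<partial>distr ?\<sigma> ?B (\<lambda>v. v))"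
        using C(2) by (subst nn_integral_distr[OF id]) (auto simp: C(1) ennreal_mult' mult_ac)
      also have "\<dots> = emeasure (density (distr ?\<sigma> ?B (\<lambda>v. v)) (\<lambda>v. ennreal (C * \<bar>v j\<bar> ^ p))) A"
        by (subst emeasure_density) auto
      finally show "emeasure (distr (tilted_product {..<N} p j) ?B ?\<pi>) A =
        emeasure (density (distr ?\<sigma> ?B (\<lambda>v. v)) (\<lambda>v. ennreal (C * \<bar>v j\<bar> ^ p))) A" .
    qed simp
    have "(\<integral>x. \<psi> (?\<pi> x) \<partial>tilted_product {..<N} p j) = (\<integral>v. \<psi> v \<partial>distr (tilted_product {..<N} p j) ?B ?\<pi>)"
      by (rule integral_distr[symmetric]) measurable
    also have "\<dots> = (\<integral>v. (C * \<bar>v j\<bar> ^ p) *\<^sub>R \<psi> v \<partial>distr ?\<sigma> ?B (\<lambda>v. v))"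
      unfolding eq using C(2) by (intro integral_density) auto
    also have "\<dots> = (\<integral>v. C * (\<bar>v j\<bar> ^ p * \<psi> v) \<partial>?\<sigma>)"
      by (subst integral_distr[OF id]) (auto simp: mult_ac)
    finally show "(\<integral>x. \<psi> (?\<pi> x) \<partial>tilted_product {..<N} p j) = C * (\<integral>v. \<bar>v j\<bar> ^ p * \<psi> v \<partial>?\<sigma>)"
      by simp
  qed
qed

lemma kac_sphere_power_sum_pos:
  assumes "N \<ge> 1" "v \<in> kac_sphere N"
  shows "(\<Sum>i<N. \<bar>v i\<bar> ^ N) > 0"
proof -
  have "\<exists>i<N. v i \<noteq> 0"
  proof (rule ccontr)
    assume "\<not> ?thesis"
    then have "(\<Sum>i<N. (v i)\<^sup>2) = 0" by simp
    then show False using assms by (simp add: kac_sphere_def)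
  qed
  then obtain i where "i < N" "v i \<noteq> 0" by blast
  then show ?thesis by (intro sum_pos2[of _ i]) auto
qed

lemma integrable_sphere_bounded:
  assumes "N \<ge> 1" "f \<in> borel_measurable (Pi\<^sub>M {..<N} (\<lambda>_. borel))"
    "\<And>v. v \<in> kac_sphere N \<Longrightarrow> \<bar>f v\<bar> \<le> (K::real)"
  shows "integrable (sphere_measure N) f"
proof -
  interpret prob_space "sphere_measure N" by (rule prob_space_sphere_measure[OF assms(1)])
  show ?thesis
    using assms(2,3) by (intro integrable_const_bound[of _ K] measurable_sphere)
       (auto simp: space_sphere_measure intro!: AE_I2)
qed

section \<open>Concentration of the tilted products\<close>

lemma tilted_square_centered_mean:
  "has_bochner_integral (tilted p) (\<lambda>x. x\<^sup>2 - (real p + 1) / 2) 0"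
proof -
  interpret prob_space "tilted p" by (rule prob_space_tilted)
  show ?thesis
    using has_bochner_integral_diff[OF tilted_square has_bochner_integral_const[of "(real p + 1) / 2"]]
    by simp
qed

lemma tilted_product_sum_second_moment:
  assumes "finite J"
  shows "has_bochner_integral (tilted_product J p j)
     (\<lambda>x. (\<Sum>i\<in>J. (x i)\<^sup>2 - (real (if i = j then p else 0) + 1) / 2)\<^sup>2)
     (\<Sum>i\<in>J. (real (if i = j then p else 0) + 1) / 2)"
  unfolding tilted_product_def
  by (rule product_second_moment[OF assms])
    (rule prob_space_tilted tilted_square_centered_mean tilted_square_centered)+

text \<open>The formula for sums also covers a single coordinate: the other summands are taken to be
  0.\<close>

lemma tilted_product_nth_second_moment:
  assumes "finite J" "j \<in> J"
  shows "has_bochner_integral (tilted_product J p j) (\<lambda>x. ((x j)\<^sup>2 - (real p + 1) / 2)\<^sup>2) ((real p + 1) / 2)"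
proof -
  have "has_bochner_integral (tilted_product J p j)
      (\<lambda>x. (\<Sum>i\<in>J. (if i = j then (x i)\<^sup>2 - (real p + 1) / 2 else 0))\<^sup>2)
      (\<Sum>i\<in>J. if i = j then (real p + 1) / 2 else 0)"
    unfolding tilted_product_def
  proof (rule product_second_moment[OF assms(1), where g = "\<lambda>i x. if i = j then x\<^sup>2 - (real p + 1) / 2 else 0"])
    fix i
    show "has_bochner_integral (tilted (if i = j then p else 0))
        (\<lambda>x. if i = j then x\<^sup>2 - (real p + 1) / 2 else 0) 0"
      using tilted_square_centered_mean[of p] by auto
    show "has_bochner_integral (tilted (if i = j then p else 0))
        (\<lambda>x. (if i = j then x\<^sup>2 - (real p + 1) / 2 else 0)\<^sup>2) (if i = j then (real p + 1) / 2 else 0)"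
      using tilted_square_centered[of p] by auto
  qed (rule prob_space_tilted)
  then show ?thesis using assms by simp
qed

text \<open>Chebyshev's inequality: x j^2 / N is near 1/2 and |x|^2 / N near 1, both with variance
  of order 1 / N, so their quotient is rarely below 2/5. The final numerator is 400 (N + 1) + 200 +
  100 N = 500 N + 600, at most 1100 N.\<close>

lemma tilted_product_coordinate_concentration:
  assumes j: "j < N"
  shows "(\<integral>x. indicator {v. (v j)\<^sup>2 < 2 / 5 * real N} (radial_projection N x) \<partial>tilted_product {..<N} N j)
    \<le> 1100 / real N"
proof -
  let ?P = "tilted_product {..<N} N j" and ?\<pi> = "radial_projection N" and ?q = "sqnorm {..<N}"
  have N: "real N \<ge> 1" using j by linarith
  interpret prob_space ?P by (rule prob_space_tilted_product)
  define S where "S x = ?q x - real N" for x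
  define T where "T x = (x j)\<^sup>2 - (real N + 1) / 2" for x :: "nat \<Rightarrow> real"
  have [measurable]: "(\<lambda>v. v j) \<in> borel_measurable (Pi\<^sub>M {..<N} (\<lambda>_. borel :: real measure))"
    using j by (intro measurable_component_singleton) simp
  have sum: "(\<Sum>i<N. (real (if i = j then N else 0) + 1) / 2) = real N"
  proof -
    have "(\<Sum>i<N. (real (if i = j then N else 0) + 1) / 2) = (\<Sum>i<N. (if i = j then real N / 2 else 0) + 1 / 2)"
      by (intro sum.cong) (auto simp: add_divide_distrib)
    then show ?thesis using j by (simp add: sum.distrib)
  qed
  have "(\<Sum>i<N. (x i)\<^sup>2 - (real (if i = j then N else 0) + 1) / 2) = S x" for x
    unfolding sum_subtractf sum S_def sqnorm_def ..
  then have S: "has_bochner_integral ?P (\<lambda>x. (S x)\<^sup>2) (real N)"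
    using tilted_product_sum_second_moment[of "{..<N}" N j] by (simp only: sum finite_lessThan)
  have T: "has_bochner_integral ?P (\<lambda>x. (T x)\<^sup>2) ((real N + 1) / 2)"
    unfolding T_def using j by (intro tilted_product_nth_second_moment) auto
  have pointwise: "indicator {v. (v j)\<^sup>2 < 2 / 5 * real N} (?\<pi> x) \<le>
      (800 * (T x)\<^sup>2 + 200 + 100 * (S x)\<^sup>2) / (real N)\<^sup>2" for x
  proof (cases "(?\<pi> x j)\<^sup>2 < 2 / 5 * real N")
    case True
    define U W where "U = (x j)\<^sup>2 / real N" and "W = ?q x / real N"
    \<comment> \<open>If W is at most 11/10, then U is at most (2/5) (11/10) = 11/25, which is below
      1/2 - 1/20. So a small share forces a deviation of 1/20 in U or of 1/10 in W.\<close>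
    have UW: "(U - 1 / 2)\<^sup>2 \<ge> 1 / 400 \<or> (W - 1)\<^sup>2 \<ge> 1 / 100"
    proof (cases "W > 11 / 10")
      case True
      then have "(1 / 10)\<^sup>2 \<le> (W - 1)\<^sup>2" by (intro power_mono) auto
      then show ?thesis by (simp add: power2_eq_square)
    next
      case False
      have "U \<le> 2 / 5 * W"
      proof (cases "?q x = 0")
        case True
        then show ?thesis using abs_le_sqrt_sqnorm[of j "{..<N}" x] j by (simp add: U_def W_def)
      next
        case False
        then have q: "?q x > 0" by (rule sqnorm_pos)
        have "(?\<pi> x j)\<^sup>2 = real N * (x j)\<^sup>2 / ?q x"
          using j by (simp add: radial_projection_nth power_divide power_mult_distrib)
        then have "real N * ((x j)\<^sup>2 / ?q x) < real N * (2 / 5)" using True by simp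
        then have "(x j)\<^sup>2 / ?q x < 2 / 5" using N by (subst (asm) mult_less_cancel_left_pos) auto
        then have "(x j)\<^sup>2 \<le> 2 / 5 * ?q x" using q by (simp add: divide_less_eq)
        then have "(x j)\<^sup>2 / real N \<le> 2 / 5 * ?q x / real N" by (rule divide_right_mono) simp
        then show ?thesis unfolding U_def W_def by simp
      qed
      then have "1 / 20 \<le> 1 / 2 - U" using False by simp
      then have "(1 / 20)\<^sup>2 \<le> (1 / 2 - U)\<^sup>2" by (intro power_mono) auto
      then show ?thesis by (simp add: power2_eq_square algebra_simps)
    qed
    then have 1: "1 \<le> 400 * (U - 1 / 2)\<^sup>2 + 100 * (W - 1)\<^sup>2"
      using zero_le_power2[of "U - 1/2"] zero_le_power2[of "W - 1"] by linarith
    \<comment> \<open>\<open>T\<close> is centred at (N + 1) / 2 rather than N / 2, whence the shift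
      by 1/2 and the additional 200 in the bound.\<close>
    have "U - 1 / 2 = (T x + 1 / 2) / real N" and W: "W - 1 = S x / real N"
      using N by (auto simp: U_def W_def T_def S_def field_simps)
    then have "(U - 1 / 2)\<^sup>2 = (T x + 1 / 2)\<^sup>2 / (real N)\<^sup>2" by (simp add: power_divide)
    also have "(T x + 1 / 2)\<^sup>2 \<le> 2 * (T x)\<^sup>2 + 1 / 2"
      using zero_le_power2[of "T x - 1 / 2"] by (simp add: power2_eq_square algebra_simps)
    finally have "(U - 1 / 2)\<^sup>2 \<le> (2 * (T x)\<^sup>2 + 1 / 2) / (real N)\<^sup>2" by (simp add: divide_right_mono)
    with 1 have "1 \<le> 400 * ((2 * (T x)\<^sup>2 + 1 / 2) / (real N)\<^sup>2) + 100 * (S x / real N)\<^sup>2"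
      unfolding W by linarith
    then show ?thesis using True by (simp add: power_divide add_divide_distrib)
  qed simp
  have "has_bochner_integral ?P (\<lambda>x. (800 * (T x)\<^sup>2 + 200 + 100 * (S x)\<^sup>2) / (real N)\<^sup>2)
      ((800 * ((real N + 1) / 2) + 200 + 100 * real N) / (real N)\<^sup>2)"
    by (intro has_bochner_integral_divide_zero has_bochner_integral_add has_bochner_integral_mult_right
        S T has_bochner_integral_const)
  then have I: "integrable ?P (\<lambda>x. (800 * (T x)\<^sup>2 + 200 + 100 * (S x)\<^sup>2) / (real N)\<^sup>2)"
    "(\<integral>x. (800 * (T x)\<^sup>2 + 200 + 100 * (S x)\<^sup>2) / (real N)\<^sup>2 \<partial>?P) = (800 * ((real N + 1) / 2) + 200 + 100 * real N) / (real N)\<^sup>2"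
    by (auto simp: has_bochner_integral_iff)
  have "(\<integral>x. indicator {v. (v j)\<^sup>2 < 2 / 5 * real N} (?\<pi> x) \<partial>?P) \<le>
      (\<integral>x. (800 * (T x)\<^sup>2 + 200 + 100 * (S x)\<^sup>2) / (real N)\<^sup>2 \<partial>?P)"
    by (rule integral_mono'[OF I(1)]) (use pointwise in auto)
  also have "\<dots> = (500 * real N + 600) / (real N)\<^sup>2" unfolding I(2) by (intro arg_cong2[where f="(/)"]) (simp_all add: field_simps)
  also have "\<dots> \<le> (1100 * real N) / (real N)\<^sup>2" using N by (intro divide_right_mono) auto
  also have "\<dots> = 1100 / real N" by (simp add: power2_eq_square)
  finally show ?thesis .
qed

section \<open>Chaoticity\<close>

definition power_sum_density :: "nat \<Rightarrow> (nat \<Rightarrow> real) \<Rightarrow> real" where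
  "power_sum_density N v = (\<Sum>i<N. \<bar>v i\<bar> ^ N) / (\<integral>v. (\<Sum>i<N. \<bar>v i\<bar> ^ N) \<partial>sphere_measure N)"

lemma PiM_nth_measurable: "j < N \<Longrightarrow> (\<lambda>v. v j) \<in> borel_measurable (Pi\<^sub>M {..<N} (\<lambda>_. borel :: real measure))"
  by (rule measurable_component_singleton) simp

lemma power_sum_measurable: "(\<lambda>v. \<Sum>i<N. \<bar>v i :: real\<bar> ^ p) \<in> borel_measurable (Pi\<^sub>M {..<N} (\<lambda>_. borel))"
proof -
  have "(\<lambda>v. \<bar>v i :: real\<bar> ^ p) \<in> borel_measurable (Pi\<^sub>M {..<N} (\<lambda>_. borel))" if "i \<in> {..<N}" for i
    using PiM_nth_measurable[of i N] that by simp
  then show ?thesis by (rule borel_measurable_sum)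
qed

lemma power_sum_density_measurable [measurable]:
  "power_sum_density N \<in> borel_measurable (Pi\<^sub>M {..<N} (\<lambda>_. borel))"
  unfolding power_sum_density_def[abs_def] using power_sum_measurable[of N N] by simp

lemma integrable_sphere_nth_power:
  assumes "N \<ge> 1" "j < N" and [measurable]: "\<psi> \<in> borel_measurable (Pi\<^sub>M {..<N} (\<lambda>_. borel))"
    and "\<And>v. \<bar>\<psi> v\<bar> \<le> (K::real)"
  shows "integrable (sphere_measure N) (\<lambda>v. \<bar>v j\<bar> ^ p * \<psi> v)"
proof (rule integrable_sphere_bounded[OF assms(1)])
  have [measurable]: "(\<lambda>v. v j) \<in> borel_measurable (Pi\<^sub>M {..<N} (\<lambda>_. borel :: real measure))"
    by (rule PiM_nth_measurable[OF assms(2)])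
  show "(\<lambda>v. \<bar>v j\<bar> ^ p * \<psi> v) \<in> borel_measurable (Pi\<^sub>M {..<N} (\<lambda>_. borel))" by measurable
  fix v assume "v \<in> kac_sphere N"
  then have "\<bar>v j\<bar> ^ p \<le> sqrt (real N) ^ p"
    using assms(2) by (intro power_mono kac_sphere_abs_le) auto
  then show "\<bar>\<bar>v j\<bar> ^ p * \<psi> v\<bar> \<le> sqrt (real N) ^ p * K"
    using assms(4)[of v] by (auto simp: abs_mult intro!: mult_mono)
qed

text \<open>Since the constant C is common to all j, every |v j|^N has integral 1 / C. Hence the
  normalisation is N / C, and the density is the mixture of the N projected products with equal
  weights 1 / N.\<close>

lemma integral_power_sum_density:
  assumes N: "N \<ge> 1" and \<psi>: "\<psi> \<in> borel_measurable (Pi\<^sub>M {..<N} (\<lambda>_. borel))"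
    and K: "\<And>v. \<bar>\<psi> v\<bar> \<le> (K::real)"
  shows "has_bochner_integral (sphere_measure N) (\<lambda>v. power_sum_density N v * \<psi> v)
    ((\<Sum>j<N. \<integral>x. \<psi> (radial_projection N x) \<partial>tilted_product {..<N} N j) / real N)"
    and "(\<integral>v. (\<Sum>i<N. \<bar>v i\<bar> ^ N) \<partial>sphere_measure N) > 0"
proof -
  let ?\<sigma> = "sphere_measure N" and ?\<pi> = "radial_projection N"
  obtain C where C: "C > 0" and *:
    "\<And>j \<psi>. j < N \<Longrightarrow> \<psi> \<in> borel_measurable (Pi\<^sub>M {..<N} (\<lambda>_. borel)) \<Longrightarrow>
      (\<integral>x. (\<psi> (?\<pi> x) :: real) \<partial>tilted_product {..<N} N j) = C * (\<integral>v. \<bar>v j\<bar> ^ N * \<psi> v \<partial>?\<sigma>)"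
    using integral_tilted_product_radial[OF N, of N] by blast
  have one: "(\<integral>v. \<bar>v j\<bar> ^ N \<partial>?\<sigma>) = 1 / C" if "j < N" for j
  proof -
    interpret prob_space "tilted_product {..<N} N j" by (rule prob_space_tilted_product)
    show ?thesis using *[OF that, of "\<lambda>_. 1"] C by (simp add: prob_space field_simps)
  qed
  have int: "integrable ?\<sigma> (\<lambda>v. \<bar>v j\<bar> ^ N)" if "j < N" for j
    using integrable_sphere_nth_power[OF N that, of "\<lambda>_. 1" 1 N] by simp
  have Z: "(\<integral>v. (\<Sum>i<N. \<bar>v i\<bar> ^ N) \<partial>?\<sigma>) = real N / C"
    by (subst Bochner_Integration.integral_sum) (auto simp: int one)
  then show "(\<integral>v. (\<Sum>i<N. \<bar>v i\<bar> ^ N) \<partial>?\<sigma>) > 0" using C N by simp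
  have "has_bochner_integral ?\<sigma> (\<lambda>v. \<bar>v j\<bar> ^ N * \<psi> v) ((\<integral>x. \<psi> (?\<pi> x) \<partial>tilted_product {..<N} N j) / C)"
    if j: "j < N" for j
    using integrable_sphere_nth_power[OF N j \<psi> K, of N] *[OF j \<psi>] C
    by (auto simp: has_bochner_integral_iff)
  then have "has_bochner_integral ?\<sigma> (\<lambda>v. (\<Sum>j<N. \<bar>v j\<bar> ^ N * \<psi> v) / (real N / C))
      ((\<Sum>j<N. (\<integral>x. \<psi> (?\<pi> x) \<partial>tilted_product {..<N} N j) / C) / (real N / C))"
    by (intro has_bochner_integral_divide_zero has_bochner_integral_sum) auto
  moreover have "(\<lambda>v. (\<Sum>j<N. \<bar>v j\<bar> ^ N * \<psi> v) / (real N / C)) = (\<lambda>v. power_sum_density N v * \<psi> v)"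
    unfolding power_sum_density_def Z sum_distrib_right[symmetric] by (simp add: mult_ac)
  moreover have "(\<Sum>j<N. (\<integral>x. \<psi> (?\<pi> x) \<partial>tilted_product {..<N} N j) / C) / (real N / C) =
      (\<Sum>j<N. \<integral>x. \<psi> (?\<pi> x) \<partial>tilted_product {..<N} N j) / real N"
    using C unfolding sum_divide_distrib[symmetric] by simp
  ultimately show "has_bochner_integral ?\<sigma> (\<lambda>v. power_sum_density N v * \<psi> v)
    ((\<Sum>j<N. \<integral>x. \<psi> (?\<pi> x) \<partial>tilted_product {..<N} N j) / real N)" by (simp only:)
qed

text \<open>Continuity refers to the topology of all functions on the naturals, measurability to a
  finite product. The inclusion is Borel measurable because on extensional functions each coordinate
  from \<open>k\<close> on is the constant \<open>undefined\<close>.\<close>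

lemma continuous_on_PiE_measurable:
  fixes \<phi> :: "(nat \<Rightarrow> real) \<Rightarrow> real"
  assumes "continuous_on ({..<k} \<rightarrow>\<^sub>E UNIV) \<phi>"
  shows "\<phi> \<in> borel_measurable (Pi\<^sub>M {..<k} (\<lambda>_. borel))"
proof -
  have "(\<lambda>x. x) \<in> Pi\<^sub>M {..<k} (\<lambda>_. borel :: real measure) \<rightarrow>\<^sub>M borel"
  proof (rule measurable_coordinatewise_then_product)
    fix i
    show "(\<lambda>x. x i) \<in> borel_measurable (Pi\<^sub>M {..<k} (\<lambda>_. borel :: real measure))"
    proof (cases "i < k")
      case False
      have "(\<lambda>x. x i :: real) \<in> borel_measurable (Pi\<^sub>M {..<k} (\<lambda>_. borel)) \<longleftrightarrow>
          (\<lambda>x. undefined :: real) \<in> borel_measurable (Pi\<^sub>M {..<k} (\<lambda>_. borel :: real measure))"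
        by (rule measurable_cong) (use False in \<open>auto simp: space_PiM PiE_iff extensional_def\<close>)
      then show ?thesis by simp
    qed (rule PiM_nth_measurable)
  qed
  then have "(\<lambda>x. x) \<in> Pi\<^sub>M {..<k} (\<lambda>_. borel :: real measure) \<rightarrow>\<^sub>M restrict_space borel ({..<k} \<rightarrow>\<^sub>E UNIV)"
    by (intro measurable_restrict_space2) (auto simp: space_PiM)
  from measurable_compose[OF this borel_measurable_continuous_on_restrict[OF assms]]
  show ?thesis .
qed

text \<open>Where W is within \<delta> of c, the difference is at most \<epsilon>; elsewhere it is
  at most 2 B, and there D / \<delta>^2 is at least 1. A majorant \<open>D\<close> stands in for the
  squared deviation so that an explicitly integrable function can be supplied.\<close>

lemma (in prob_space) expectation_near:
  fixes W D :: "'a \<Rightarrow> real" and \<xi> :: "real \<Rightarrow> real"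
  assumes [measurable]: "W \<in> borel_measurable M" "\<xi> \<in> borel_measurable borel"
    and D: "integrable M D" "\<And>y. y \<in> space M \<Longrightarrow> (W y - c)\<^sup>2 \<le> D y"
    and B: "\<And>w. \<bar>\<xi> w\<bar> \<le> B" and "\<delta> > 0"
    and near: "\<And>w. \<bar>w - c\<bar> < \<delta> \<Longrightarrow> \<bar>\<xi> w - \<xi> c\<bar> \<le> \<epsilon>" and "\<epsilon> \<ge> 0"
  shows "\<bar>(\<integral>y. \<xi> (W y) \<partial>M) - \<xi> c\<bar> \<le> \<epsilon> + 2 * B / \<delta>\<^sup>2 * (\<integral>y. D y \<partial>M)"
proof -
  have B0: "B \<ge> 0" using B[of 0] by linarith
  have bound: "\<bar>\<xi> (W y) - \<xi> c\<bar> \<le> \<epsilon> + 2 * B / \<delta>\<^sup>2 * D y" if "y \<in> space M" for y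
  proof (cases "\<bar>W y - c\<bar> < \<delta>")
    case True
    have "0 \<le> 2 * B / \<delta>\<^sup>2 * D y"
      using B0 order_trans[OF zero_le_power2 D(2)[OF that]] by simp
    then show ?thesis using near[OF True] by linarith
  next
    case False
    then have "\<delta>\<^sup>2 \<le> \<bar>W y - c\<bar>\<^sup>2" using \<open>\<delta> > 0\<close> by (intro power_mono) auto
    then have "\<delta>\<^sup>2 \<le> D y" using D(2)[OF that] by simp
    then have "1 \<le> D y / \<delta>\<^sup>2" using \<open>\<delta> > 0\<close> by simp
    then have "2 * B * 1 \<le> 2 * B * (D y / \<delta>\<^sup>2)" using B0 by (intro mult_left_mono) auto
    moreover have "\<bar>\<xi> (W y) - \<xi> c\<bar> \<le> 2 * B" using B[of "W y"] B[of c] by linarith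
    ultimately show ?thesis using \<open>\<epsilon> \<ge> 0\<close> by simp
  qed
  have int: "integrable M (\<lambda>y. \<xi> (W y))"
    by (rule integrable_const_bound[of _ B]) (auto simp: B)
  have "\<bar>(\<integral>y. \<xi> (W y) \<partial>M) - \<xi> c\<bar> = \<bar>\<integral>y. \<xi> (W y) - \<xi> c \<partial>M\<bar>"
    using int by (simp add: prob_space)
  also have "\<dots> \<le> (\<integral>y. \<bar>\<xi> (W y) - \<xi> c\<bar> \<partial>M)"
    by (rule integral_abs_bound)
  also have "\<dots> \<le> (\<integral>y. \<epsilon> + 2 * B / \<delta>\<^sup>2 * D y \<partial>M)"
    using int D(1) bound by (intro integral_mono) auto
  also have "\<dots> = \<epsilon> + 2 * B / \<delta>\<^sup>2 * (\<integral>y. D y \<partial>M)"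
    using D(1) by (simp add: prob_space)
  finally show ?thesis .
qed

text \<open>With the observed coordinates fixed, the projection only moves them along a ray, at the
  scalar parameter w = |x|^2 / N taken over all N coordinates. Concentration of w at 1 therefore has
  to be combined only with continuity in one real variable.\<close>

lemma isCont_ray:
  fixes \<phi> :: "(nat \<Rightarrow> real) \<Rightarrow> real"
  assumes "continuous_on ({..<k} \<rightarrow>\<^sub>E UNIV) \<phi>"
  shows "isCont (\<lambda>w. \<phi> (\<lambda>i\<in>{..<k}. x i / sqrt w)) 1"
proof -
  have "continuous_on {0<..} (\<lambda>w i. if i < k then x i / sqrt w else undefined)"
  proof (rule continuous_on_coordinatewise_then_product)
    fix i
    show "continuous_on {0<..} (\<lambda>w. if i < k then x i / sqrt w else undefined)"
      by (cases "i < k") (auto intro!: continuous_intros)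
  qed
  then have "continuous_on {0<..} (\<lambda>w. \<lambda>i\<in>{..<k}. x i / sqrt w)"
    by (simp add: restrict_def)
  then have "continuous_on {0<..} (\<lambda>w. \<phi> (\<lambda>i\<in>{..<k}. x i / sqrt w))"
    by (rule continuous_on_compose2[OF assms]) (simp add: image_subset_iff)
  then show ?thesis by (simp add: continuous_on_eq_continuous_at)
qed

lemma radial_projection_merge:
  assumes "k \<le> N" "N \<ge> 1"
  shows "restrict (radial_projection N (merge {..<k} {k..<N} (x, y))) {..<k} =
    (\<lambda>i\<in>{..<k}. x i / sqrt ((sqnorm {..<k} x + sqnorm {k..<N} y) / real N))"
proof -
  have "sqnorm {..<N} (merge {..<k} {k..<N} (x, y)) = sqnorm ({..<k} \<union> {k..<N}) (merge {..<k} {k..<N} (x, y))"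
    using assms by (intro arg_cong2[where f=sqnorm]) auto
  also have "\<dots> = sqnorm {..<k} x + sqnorm {k..<N} y"
    unfolding sqnorm_def by (subst sum.union_disjoint) (auto simp: merge_def intro!: arg_cong2[where f="(+)"] sum.cong)
  finally have "sqnorm {..<N} (merge {..<k} {k..<N} (x, y)) = sqnorm {..<k} x + sqnorm {k..<N} y" .
  then show ?thesis
    using assms by (intro restrict_ext) (simp add: radial_projection_nth merge_def real_sqrt_divide)
qed

lemma power2_add_le: "(x + y)\<^sup>2 \<le> 2 * x\<^sup>2 + 2 * (y :: real)\<^sup>2"
  using zero_le_power2[of "x - y"] by (simp add: power2_sum power2_diff)

text \<open>Here \<open>a\<close> is the squared norm of the k frozen coordinates. The remaining
  ones contribute mean N / 2 + (N - k) / 2 = N - k / 2 with the same variance, so the deviation of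
  the total from N is a centred variable plus a - k / 2. The bound is of order 1 / N for fixed
  \<open>a\<close> and does not depend on j.\<close>

lemma tail_second_moment:
  fixes a :: real
  assumes "k \<le> j" "j < N"
  obtains D where "integrable (tilted_product {k..<N} N j) D"
    "\<And>y. ((a + sqnorm {k..<N} y) / real N - 1)\<^sup>2 \<le> D y"
    "(\<integral>y. D y \<partial>tilted_product {k..<N} N j) \<le> (2 * real N + 2 * (a - real k / 2)\<^sup>2) / (real N)\<^sup>2"
proof -
  let ?P = "tilted_product {k..<N} N j"
  interpret prob_space ?P by (rule prob_space_tilted_product)
  define S where "S y = sqnorm {k..<N} y - (real N - real k / 2)" for y
  have sum: "(\<Sum>i=k..<N. (real (if i = j then N else 0) + 1) / 2) = real N - real k / 2"
  proof -
    have "(\<Sum>i=k..<N. (real (if i = j then N else 0) + 1) / 2) = (\<Sum>i=k..<N. (if i = j then real N / 2 else 0) + 1 / 2)"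
      by (intro sum.cong) (auto simp: add_divide_distrib)
    also have "\<dots> = real N / 2 + real (N - k) * (1 / 2)"
      unfolding sum.distrib using assms by simp
    finally show ?thesis using assms by (simp add: of_nat_diff field_simps)
  qed
  have "(\<Sum>i=k..<N. (y i)\<^sup>2 - (real (if i = j then N else 0) + 1) / 2) = S y" for y
    unfolding sum_subtractf sum S_def sqnorm_def ..
  then have S: "has_bochner_integral ?P (\<lambda>y. (S y)\<^sup>2) (real N - real k / 2)"
    using tilted_product_sum_second_moment[of "{k..<N}" N j] by (simp only: sum finite_atLeastLessThan)
  define D where "D y = (2 * (S y)\<^sup>2 + 2 * (a - real k / 2)\<^sup>2) / (real N)\<^sup>2" for y
  have D: "has_bochner_integral ?P D ((2 * (real N - real k / 2) + 2 * (a - real k / 2)\<^sup>2) / (real N)\<^sup>2)"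
    unfolding D_def by (intro has_bochner_integral_divide_zero has_bochner_integral_add
        has_bochner_integral_mult_right S has_bochner_integral_const)
  show ?thesis
  proof (rule that)
    show "integrable ?P D" using D by (simp add: has_bochner_integral_iff)
    show "(\<integral>y. D y \<partial>?P) \<le> (2 * real N + 2 * (a - real k / 2)\<^sup>2) / (real N)\<^sup>2"
      unfolding has_bochner_integral_integral_eq[OF D] by (intro divide_right_mono) auto
    fix y
    have "(a + sqnorm {k..<N} y) / real N - 1 = (S y + (a - real k / 2)) / real N"
      using assms by (simp add: S_def field_simps)
    then have "((a + sqnorm {k..<N} y) / real N - 1)\<^sup>2 = (S y + (a - real k / 2))\<^sup>2 / (real N)\<^sup>2"
      by (simp add: power_divide)
    also have "(S y + (a - real k / 2))\<^sup>2 \<le> 2 * (S y)\<^sup>2 + 2 * (a - real k / 2)\<^sup>2"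
      by (rule power2_add_le)
    finally show "((a + sqnorm {k..<N} y) / real N - 1)\<^sup>2 \<le> D y"
      by (simp add: D_def divide_right_mono)
  qed
qed

text \<open>Since \<open>j N\<close> is at least k, the first k coordinates are exactly Gaussian and
  independent of the tail. Fubini freezes them; the integral over the tail then tends to \<phi> x by
  concentration, and dominated convergence with the constant \<open>B\<close> finishes the
  limit.\<close>

lemma tilted_product_marginal_limit:
  fixes \<phi> :: "(nat \<Rightarrow> real) \<Rightarrow> real" and j :: "nat \<Rightarrow> nat"
  assumes cont: "continuous_on ({..<k} \<rightarrow>\<^sub>E UNIV) \<phi>"
    and B: "\<And>x. x \<in> {..<k} \<rightarrow>\<^sub>E UNIV \<Longrightarrow> \<bar>\<phi> x\<bar> \<le> B"
    and j: "\<And>N. N > k \<Longrightarrow> k \<le> j N \<and> j N < N"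
  shows "(\<lambda>N. \<integral>x. \<phi> (restrict (radial_projection N x) {..<k}) \<partial>tilted_product {..<N} N (j N))
    \<longlonglongrightarrow> (\<integral>x. \<phi> x \<partial>Pi\<^sub>M {..<k} (\<lambda>_. tilted 0))"
proof -
  have \<phi>[measurable]: "\<phi> \<in> borel_measurable (Pi\<^sub>M {..<k} (\<lambda>_. borel))"
    by (rule continuous_on_PiE_measurable[OF cont])
  let ?G = "Pi\<^sub>M {..<k} (\<lambda>_. tilted 0)"
  have sets_G[measurable_cong]: "sets ?G = sets (Pi\<^sub>M {..<k} (\<lambda>_. borel))"
    by (rule sets_PiM_cong) auto
  interpret G: product_prob_space "\<lambda>_::nat. tilted 0" "{..<k}" by (rule product_prob_space_tilted)
  define \<xi> where "\<xi> x w = \<phi> (\<lambda>i\<in>{..<k}. x i / sqrt w)" for x w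
  define W where "W N x y = (sqnorm {..<k} x + sqnorm {k..<N} y) / real N" for N and x y :: "nat \<Rightarrow> real"
  have \<xi>_bound: "\<bar>\<xi> x w\<bar> \<le> B" for x w unfolding \<xi>_def by (rule B) auto
  have \<xi>_meas: "\<xi> x \<in> borel_measurable borel" for x
    unfolding \<xi>_def[abs_def] by (rule measurable_compose[OF _ \<phi>]) measurable
  define I where "I N x = (\<integral>y. \<xi> x (W N x y) \<partial>tilted_product {k..<N} N (j N))" for N x
  have I_meas: "I N \<in> borel_measurable ?G" for N
  proof -
    interpret P: prob_space "tilted_product {k..<N} N (j N)" by (rule prob_space_tilted_product)
    have nth: "(\<lambda>p. fst p i) \<in> borel_measurable (?G \<Otimes>\<^sub>M tilted_product {k..<N} N (j N))" if "i < k" for i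
      by (rule measurable_compose[OF measurable_fst])
         (use PiM_nth_measurable[OF that] in \<open>simp cong: measurable_cong_sets add: sets_G\<close>)
    have W: "(\<lambda>p. W N (fst p) (snd p)) \<in> borel_measurable (?G \<Otimes>\<^sub>M tilted_product {k..<N} N (j N))"
      unfolding W_def by measurable
    have "(\<lambda>p. \<lambda>i\<in>{..<k}. fst p i / sqrt (W N (fst p) (snd p))) \<in>
        ?G \<Otimes>\<^sub>M tilted_product {k..<N} N (j N) \<rightarrow>\<^sub>M Pi\<^sub>M {..<k} (\<lambda>_. borel)"
      by (rule measurable_restrict) (use nth W in auto)
    then have "(\<lambda>p. \<xi> (fst p) (W N (fst p) (snd p))) \<in> borel_measurable (?G \<Otimes>\<^sub>M tilted_product {k..<N} N (j N))"
      unfolding \<xi>_def by (rule measurable_compose[OF _ \<phi>])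
    then show ?thesis
      unfolding I_def[abs_def] by (intro P.borel_measurable_lebesgue_integral) (simp add: case_prod_beta')
  qed
  have I_bound: "\<bar>I N x\<bar> \<le> B" for N x
  proof -
    interpret P: prob_space "tilted_product {k..<N} N (j N)" by (rule prob_space_tilted_product)
    have "\<bar>I N x\<bar> \<le> (\<integral>y. \<bar>\<xi> x (W N x y)\<bar> \<partial>tilted_product {k..<N} N (j N))"
      unfolding I_def by (rule integral_abs_bound)
    also have "\<dots> \<le> (\<integral>y. B \<partial>tilted_product {k..<N} N (j N))"
      using order_trans[OF abs_ge_zero \<xi>_bound] by (intro integral_mono') (auto simp: \<xi>_bound)
    finally show ?thesis by (simp add: P.prob_space)
  qed
  have fubini: "(\<integral>x. \<phi> (restrict (radial_projection N x) {..<k}) \<partial>tilted_product {..<N} N (j N)) = (\<integral>x. I N x \<partial>?G)"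
    if N: "N > k" for N
  proof -
    let ?M = "\<lambda>i. tilted (if i = j N then N else 0)"
    interpret product_prob_space ?M "{..<N}" by (rule product_prob_space_tilted)
    have un: "{..<k} \<union> {k..<N} = {..<N}" using N by auto
    have G: "Pi\<^sub>M {..<k} ?M = ?G" using j[OF N] by (intro PiM_cong) auto
    have "(\<lambda>v. restrict v {..<k}) \<in> Pi\<^sub>M {..<N} (\<lambda>_. borel :: real measure) \<rightarrow>\<^sub>M Pi\<^sub>M {..<k} (\<lambda>_. borel)"
      using N by (intro measurable_restrict_subset) auto
    then have [measurable]: "(\<lambda>x. \<phi> (restrict (radial_projection N x) {..<k})) \<in> borel_measurable (Pi\<^sub>M {..<N} (\<lambda>_. borel))"
      by (intro measurable_compose[OF radial_projection_measurable measurable_compose[OF _ \<phi>]])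
    have "integrable (tilted_product {..<N} N (j N)) (\<lambda>x. \<phi> (restrict (radial_projection N x) {..<k}))"
    proof -
      interpret T: prob_space "tilted_product {..<N} N (j N)" by (rule prob_space_tilted_product)
      have "\<bar>\<phi> (restrict (radial_projection N x) {..<k})\<bar> \<le> B" for x by (rule B) simp
      then show ?thesis by (intro T.integrable_const_bound[of _ B]) auto
    qed
    then have "(\<integral>x. \<phi> (restrict (radial_projection N x) {..<k}) \<partial>Pi\<^sub>M ({..<k} \<union> {k..<N}) ?M) =
        (\<integral>x. \<integral>y. \<phi> (restrict (radial_projection N (merge {..<k} {k..<N} (x, y))) {..<k}) \<partial>Pi\<^sub>M {k..<N} ?M \<partial>Pi\<^sub>M {..<k} ?M)"
      unfolding tilted_product_def un[symmetric] by (intro product_integral_fold) auto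
    then show ?thesis
      using N unfolding un G I_def \<xi>_def W_def tilted_product_def
      by (simp add: radial_projection_merge)
  qed
  have I_lim: "(\<lambda>N. I N x) \<longlonglongrightarrow> \<phi> x" if x: "x \<in> {..<k} \<rightarrow>\<^sub>E UNIV" for x
  proof (rule LIMSEQ_I)
    fix r :: real assume r: "r > 0"
    have \<xi>1: "\<xi> x 1 = \<phi> x" using x by (simp add: \<xi>_def)
    have "isCont (\<xi> x) 1" unfolding \<xi>_def[abs_def] by (rule isCont_ray[OF cont])
    then obtain d where d: "d > 0" "\<And>w. \<bar>w - 1\<bar> < d \<Longrightarrow> \<bar>\<xi> x w - \<xi> x 1\<bar> < r / 2"
      using r unfolding continuous_at_eps_delta dist_real_def by (meson half_gt_zero)
    define b where "b N = 2 * B / d\<^sup>2 * ((2 * real N + 2 * (sqnorm {..<k} x - real k / 2)\<^sup>2) / (real N)\<^sup>2)" for N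
    have B0: "B \<ge> 0" using \<xi>_bound[of x 0] by linarith
    have near: "\<bar>I N x - \<phi> x\<bar> \<le> r / 2 + b N" if N: "N > k" for N
    proof -
      interpret P: prob_space "tilted_product {k..<N} N (j N)" by (rule prob_space_tilted_product)
      obtain D where D: "integrable (tilted_product {k..<N} N (j N)) D"
        "\<And>y. ((sqnorm {..<k} x + sqnorm {k..<N} y) / real N - 1)\<^sup>2 \<le> D y"
        "(\<integral>y. D y \<partial>tilted_product {k..<N} N (j N)) \<le> (2 * real N + 2 * (sqnorm {..<k} x - real k / 2)\<^sup>2) / (real N)\<^sup>2"
        using tail_second_moment[of k "j N" N "sqnorm {..<k} x"] j[OF N] by blast
      have "\<bar>I N x - \<xi> x 1\<bar> \<le> r / 2 + 2 * B / d\<^sup>2 * (\<integral>y. D y \<partial>tilted_product {k..<N} N (j N))"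
        unfolding I_def
      proof (rule P.expectation_near[OF _ \<xi>_meas D(1) _ \<xi>_bound d(1)])
        show "W N x \<in> borel_measurable (tilted_product {k..<N} N (j N))"
          unfolding W_def[abs_def] by measurable
        show "(W N x y - 1)\<^sup>2 \<le> D y" for y unfolding W_def by (rule D(2))
      qed (use d(2) r in \<open>auto intro: less_imp_le\<close>)
      also have "\<dots> \<le> r / 2 + b N"
        unfolding b_def using D(3) B0 by (intro add_left_mono mult_left_mono) auto
      finally show ?thesis unfolding \<xi>1 .
    qed
    have "(\<lambda>N. (2 * real N + c) / (real N)\<^sup>2) \<longlonglongrightarrow> 0" for c by real_asymp
    then have "b \<longlonglongrightarrow> 0" unfolding b_def by (intro tendsto_mult_right_zero)
    then have "\<forall>\<^sub>F N in sequentially. b N < r / 2" using r by (intro order_tendstoD) auto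
    then have "\<forall>\<^sub>F N in sequentially. norm (I N x - \<phi> x) < r"
      using eventually_gt_at_top[of k] by eventually_elim (use near in fastforce)
    then show "\<exists>no. \<forall>n\<ge>no. norm (I n x - \<phi> x) < r" by (simp add: eventually_sequentially)
  qed
  have "(\<lambda>N. \<integral>x. I N x \<partial>?G) \<longlonglongrightarrow> (\<integral>x. \<phi> x \<partial>?G)"
  proof (rule integral_dominated_convergence[where w="\<lambda>_. B"])
    show "AE x in ?G. (\<lambda>N. I N x) \<longlonglongrightarrow> \<phi> x" by (intro AE_I2 I_lim) (simp add: space_PiM)
  qed (auto simp: I_meas I_bound)
  moreover have "\<forall>\<^sub>F N in sequentially. (\<integral>x. I N x \<partial>?G) =
      (\<integral>x. \<phi> (restrict (radial_projection N x) {..<k}) \<partial>tilted_product {..<N} N (j N))"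
    using eventually_gt_at_top[of k] by eventually_elim (simp add: fubini)
  ultimately show ?thesis by (rule Lim_transform_eventually)
qed

lemma power_sum_density_marginal_limit:
  fixes \<phi> :: "(nat \<Rightarrow> real) \<Rightarrow> real"
  assumes cont: "continuous_on ({..<k} \<rightarrow>\<^sub>E UNIV) \<phi>"
    and B: "\<And>x. x \<in> {..<k} \<rightarrow>\<^sub>E UNIV \<Longrightarrow> \<bar>\<phi> x\<bar> \<le> B"
  shows "(\<lambda>N. \<integral>v. power_sum_density N v * \<phi> (restrict v {..<k}) \<partial>sphere_measure N)
    \<longlonglongrightarrow> (\<integral>x. \<phi> x \<partial>Pi\<^sub>M {..<k} (\<lambda>_. tilted 0))"
proof -
  define E where "E N j = (\<integral>x. \<phi> (restrict (radial_projection N x) {..<k}) \<partial>tilted_product {..<N} N j)" for N j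
  define L where "L = (\<integral>x. \<phi> x \<partial>Pi\<^sub>M {..<k} (\<lambda>_. tilted 0))"
  have \<phi>: "\<phi> \<in> borel_measurable (Pi\<^sub>M {..<k} (\<lambda>_. borel))"
    by (rule continuous_on_PiE_measurable[OF cont])
  have "(\<lambda>i\<in>{..<k}. 0) \<in> {..<k} \<rightarrow>\<^sub>E (UNIV :: real set)" by simp
  from B[OF this] have B0: "B \<ge> 0" by linarith
  have abs_bound: "\<bar>\<integral>x. f x \<partial>M\<bar> \<le> B" if "prob_space M" "\<And>x. x \<in> space M \<Longrightarrow> \<bar>f x\<bar> \<le> B"
    for f and M :: "(nat \<Rightarrow> real) measure"
  proof -
    interpret prob_space M by fact
    have "\<bar>\<integral>x. f x \<partial>M\<bar> \<le> (\<integral>x. \<bar>f x\<bar> \<partial>M)" by (rule integral_abs_bound)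
    also have "\<dots> \<le> (\<integral>x. B \<partial>M)" using B0 that(2) by (intro integral_mono') auto
    finally show ?thesis by (simp add: prob_space)
  qed
  have E_bound: "\<bar>E N j\<bar> \<le> B" for N j
    unfolding E_def by (intro abs_bound prob_space_tilted_product B) auto
  interpret G: product_prob_space "\<lambda>_::nat. tilted 0" "{..<k}" by (rule product_prob_space_tilted)
  have L_bound: "\<bar>L\<bar> \<le> B"
    unfolding L_def by (intro abs_bound G.prob_space_axioms B) (auto simp: space_PiM)
  \<comment> \<open>Taking the worst index for each \<open>N\<close> turns the limit along a sequence of indices into one
    that is uniform in the index.\<close>
  have "\<exists>j. \<forall>N>k. j N \<in> {k..<N} \<and> (\<forall>i\<in>{k..<N}. \<bar>E N i - L\<bar> \<le> \<bar>E N (j N) - L\<bar>)"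
  proof -
    have "\<exists>l. l \<in> {k..<N} \<and> (\<forall>i\<in>{k..<N}. \<bar>E N i - L\<bar> \<le> \<bar>E N l - L\<bar>)" if "N > k" for N
    proof -
      let ?S = "(\<lambda>i. \<bar>E N i - L\<bar>) ` {k..<N}"
      have "Max ?S \<in> ?S" using that by (intro Max_in) auto
      then obtain l where l: "l \<in> {k..<N}" "Max ?S = \<bar>E N l - L\<bar>" by auto
      have "\<bar>E N i - L\<bar> \<le> Max ?S" if "i \<in> {k..<N}" for i using that by (intro Max_ge) auto
      with l show ?thesis by auto
    qed
    then show ?thesis by metis
  qed
  then obtain j where j: "\<And>N. N > k \<Longrightarrow> j N \<in> {k..<N}"
    "\<And>N i. N > k \<Longrightarrow> i \<in> {k..<N} \<Longrightarrow> \<bar>E N i - L\<bar> \<le> \<bar>E N (j N) - L\<bar>" by blast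
  have lim: "(\<lambda>N. E N (j N)) \<longlonglongrightarrow> L"
    unfolding E_def L_def by (rule tilted_product_marginal_limit[OF cont B]) (use j(1) in auto)
  define R where "R N = \<bar>E N (j N) - L\<bar>" for N
  have bound: "\<bar>(\<integral>v. power_sum_density N v * \<phi> (restrict v {..<k}) \<partial>sphere_measure N) - L\<bar>
      \<le> real k * (2 * B) / real N + R N" if N: "N > k" for N
  proof -
    have "(\<lambda>v. restrict v {..<k}) \<in> Pi\<^sub>M {..<N} (\<lambda>_. borel :: real measure) \<rightarrow>\<^sub>M Pi\<^sub>M {..<k} (\<lambda>_. borel)"
      using N by (intro measurable_restrict_subset) auto
    then have meas: "(\<lambda>v. \<phi> (restrict v {..<k})) \<in> borel_measurable (Pi\<^sub>M {..<N} (\<lambda>_. borel))"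
      by (rule measurable_compose[OF _ \<phi>])
    have "(\<integral>v. power_sum_density N v * \<phi> (restrict v {..<k}) \<partial>sphere_measure N) = (\<Sum>i<N. E N i) / real N"
      unfolding E_def using N
      by (intro has_bochner_integral_integral_eq integral_power_sum_density(1)[where K=B] meas B) auto
    then have "(\<integral>v. power_sum_density N v * \<phi> (restrict v {..<k}) \<partial>sphere_measure N) - L = (\<Sum>i<N. E N i - L) / real N"
      using N by (simp add: sum_subtractf field_simps)
    moreover have "\<bar>\<Sum>i<N. E N i - L\<bar> \<le> real k * (2 * B) + real N * R N"
    proof -
      have "\<bar>\<Sum>i<N. E N i - L\<bar> \<le> (\<Sum>i<N. \<bar>E N i - L\<bar>)" by (rule sum_abs)
      also have "\<dots> = (\<Sum>i<k. \<bar>E N i - L\<bar>) + (\<Sum>i=k..<N. \<bar>E N i - L\<bar>)"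
        using N by (simp add: lessThan_atLeast0 sum.atLeastLessThan_concat)
      \<comment> \<open>For an index below k the tilted coordinate is among the observed ones, and
        only the trivial bound 2 B is used. These k indices carry the vanishing weight k /
        N.\<close>
      also have "\<dots> \<le> (\<Sum>i<k. 2 * B) + (\<Sum>i=k..<N. R N)"
      proof (intro add_mono sum_mono)
        show "\<bar>E N i - L\<bar> \<le> 2 * B" for i using E_bound[of N i] L_bound by linarith
        show "\<bar>E N i - L\<bar> \<le> R N" if "i \<in> {k..<N}" for i unfolding R_def by (rule j(2)[OF N that])
      qed
      also have "\<dots> \<le> real k * (2 * B) + real N * R N"
        by (auto simp: R_def intro!: mult_right_mono)
      finally show ?thesis .
    qed
    then have "\<bar>\<Sum>i<N. E N i - L\<bar> / real N \<le> (real k * (2 * B) + real N * R N) / real N"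
      by (intro divide_right_mono) auto
    ultimately show ?thesis
      using N by (simp add: add_divide_distrib)
  qed
  have "(\<lambda>N. real k * (2 * B) / real N) \<longlonglongrightarrow> 0" by (rule lim_const_over_n)
  moreover have "R \<longlonglongrightarrow> 0"
    using tendsto_rabs[OF tendsto_diff[OF lim tendsto_const[of L]]] by (simp add: R_def[abs_def])
  ultimately have "(\<lambda>N. real k * (2 * B) / real N + R N) \<longlonglongrightarrow> 0"
    using tendsto_add by fastforce
  then have "(\<lambda>N. (\<integral>v. power_sum_density N v * \<phi> (restrict v {..<k}) \<partial>sphere_measure N) - L) \<longlonglongrightarrow> 0"
    by (rule Lim_null_comparison[rotated])
       (use bound in \<open>auto intro!: eventually_mono[OF eventually_gt_at_top[of k]]\<close>)
  then show ?thesis unfolding L_def by (rule LIM_zero_cancel)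
qed

section \<open>Entropy\<close>

lemma ext_integral_eq_integral:
  assumes "integrable M g"
  shows "ext_integral M g = ereal (\<integral>x. g x \<partial>M)"
proof -
  have fin: "(\<integral>\<^sup>+x. ennreal (g x) \<partial>M) \<noteq> \<infinity>" "(\<integral>\<^sup>+x. ennreal (- g x) \<partial>M) \<noteq> \<infinity>"
    using assms by (auto simp: real_integrable_def)
  have "enn2ereal a = ereal (enn2real a)" if "a \<noteq> \<infinity>" for a
    using that by (cases a) (auto simp: enn2ereal_ennreal)
  then show ?thesis
    using fin unfolding ext_integral_def real_lebesgue_integral_def[OF assms] by simp
qed

lemma ext_integral_cong_AE:
  assumes "AE x in M. f x = g x"
  shows "ext_integral M f = ext_integral M g"
proof -
  have "(\<integral>\<^sup>+x. ennreal (f x) \<partial>M) = (\<integral>\<^sup>+x. ennreal (g x) \<partial>M)"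
    by (rule nn_integral_cong_AE) (use assms in \<open>eventually_elim, simp\<close>)
  moreover have "(\<integral>\<^sup>+x. ennreal (- f x) \<partial>M) = (\<integral>\<^sup>+x. ennreal (- g x) \<partial>M)"
    by (rule nn_integral_cong_AE) (use assms in \<open>eventually_elim, simp\<close>)
  ultimately show ?thesis by (simp add: ext_integral_def)
qed

lemma has_bochner_integral_tilted_exp_square:
  assumes "s < 1"
  shows "has_bochner_integral (tilted 0) (\<lambda>x. exp (s * x\<^sup>2)) (1 / sqrt (1 - s))"
  unfolding tilted_def
proof (rule has_bochner_integral_density)
  \<comment> \<open>The weight exp(- (1 - s) x^2) belongs to the normal law of variance 1 / (2 (1 -
    s)).\<close>
  define \<tau> where "\<tau> = 1 / sqrt (2 * (1 - s))"
  have \<tau>: "\<tau> > 0" "\<tau>\<^sup>2 = 1 / (2 * (1 - s))"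
    using assms by (auto simp: \<tau>_def power_divide)
  have "2 * pi * \<tau>\<^sup>2 = pi / (1 - s)" "- (x - 0)\<^sup>2 / (2 * \<tau>\<^sup>2) = - (1 - s) * x\<^sup>2" for x
    using assms by (auto simp: \<tau>(2) field_simps)
  then have n: "normal_density 0 \<tau> x = sqrt (1 - s) / sqrt pi * exp (- (1 - s) * x\<^sup>2)" for x
    unfolding normal_density_def by (simp add: real_sqrt_divide)
  have eq: "normal_density 0 \<tau> x / sqrt (1 - s) = tilted_density 0 x *\<^sub>R exp (s * x\<^sup>2)" for x
    using assms by (simp add: n tilted_density_0 exp_add[symmetric] algebra_simps)
  have "has_bochner_integral lborel (normal_density 0 \<tau>) 1"
    using \<tau>(1) by (simp add: has_bochner_integral_iff)
  from has_bochner_integral_divide_zero[OF this, of "sqrt (1 - s)"]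
  show "has_bochner_integral lborel (\<lambda>x. tilted_density 0 x *\<^sub>R exp (s * x\<^sup>2)) (1 / sqrt (1 - s))"
    unfolding eq .
qed auto

text \<open>
  A Chernoff bound with exponent \<open>5 / 6 (x\<^sub>j\<^sup>2 - 2 / 5 |x|\<^sup>2)\<close>, which is
  \<open>x\<^sub>j\<^sup>2 / 2\<close> minus a third of the sum of the other squares.
\<close>

lemma sphere_coordinate_tail:
  assumes j: "j < N"
  shows "(\<integral>v. indicator {v. 2 / 5 * real N \<le> (v j)\<^sup>2} v \<partial>sphere_measure N) \<le> sqrt 2 * sqrt (3 / 4) ^ (N - 1)"
proof -
  have N: "N \<ge> 1" using j by simp
  let ?A = "{v :: nat \<Rightarrow> real. 2 / 5 * real N \<le> (v j)\<^sup>2}" and ?\<pi> = "radial_projection N" and ?P = "tilted_product {..<N} 0 j"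
  obtain C where C: "C > 0" and *:
    "\<And>j \<psi>. j < N \<Longrightarrow> \<psi> \<in> borel_measurable (Pi\<^sub>M {..<N} (\<lambda>_. borel)) \<Longrightarrow>
      (\<integral>x. (\<psi> (?\<pi> x) :: real) \<partial>tilted_product {..<N} 0 j) = C * (\<integral>v. \<bar>v j\<bar> ^ 0 * \<psi> v \<partial>sphere_measure N)"
    using integral_tilted_product_radial[OF N, of 0] by blast
  \<comment> \<open>For p = 0 both sides are probabilities, so the uniform measure is exactly the
    projected Gaussian product.\<close>
  have C1: "C = 1"
  proof -
    interpret S: prob_space "sphere_measure N" by (rule prob_space_sphere_measure[OF N])
    interpret T: prob_space ?P by (rule prob_space_tilted_product)
    show ?thesis using *[OF j, of "\<lambda>_. 1"] by (simp add: S.prob_space T.prob_space)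
  qed
  have [measurable]: "(\<lambda>v. v j) \<in> borel_measurable (Pi\<^sub>M {..<N} (\<lambda>_. borel :: real measure))"
    by (rule PiM_nth_measurable[OF j])
  have "(\<lambda>v. indicator {2 / 5 * real N..} ((v j)\<^sup>2) :: real) \<in> borel_measurable (Pi\<^sub>M {..<N} (\<lambda>_. borel))"
    by measurable
  also have "(\<lambda>v. indicator {2 / 5 * real N..} ((v j)\<^sup>2) :: real) = (\<lambda>v. indicator ?A v)"
    by (auto simp: indicator_def)
  finally have "(\<integral>v. indicator ?A v \<partial>sphere_measure N) = (\<integral>x. (indicator ?A (?\<pi> x) :: real) \<partial>?P)"
    using *[OF j, of "indicator ?A"] by (simp only: C1 power_0 mult_1)
  also have "\<dots> \<le> (\<integral>x. (\<Prod>i<N. exp ((if i = j then 1 / 2 else - 1 / 3) * (x i)\<^sup>2)) \<partial>?P)"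
  proof (rule integral_mono')
    interpret product_prob_space "\<lambda>i. tilted (if i = j then 0 else 0)" "{..<N}" by (rule product_prob_space_tilted)
    show "integrable ?P (\<lambda>x. \<Prod>i<N. exp ((if i = j then 1 / 2 else - 1 / 3) * (x i)\<^sup>2))"
      unfolding tilted_product_def
      by (rule product_integrable_prod)
        (use has_bochner_integral_tilted_exp_square[of "1/2"] has_bochner_integral_tilted_exp_square[of "- 1/3"] in
          \<open>auto simp: has_bochner_integral_iff\<close>)
    fix x
    show "indicator ?A (?\<pi> x) \<le> (\<Prod>i<N. exp ((if i = j then 1 / 2 else - 1 / 3) * (x i)\<^sup>2))"
    proof (cases "?\<pi> x \<in> ?A")
      case True
      \<comment> \<open>The origin projects to 0, which lies below the positive threshold.\<close>
      have q: "sqnorm {..<N} x > 0"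
      proof (rule sqnorm_pos, rule)
        assume "sqnorm {..<N} x = 0"
        then show False using True j by (simp add: radial_projection_nth)
      qed
      have "(?\<pi> x j)\<^sup>2 = real N * ((x j)\<^sup>2 / sqnorm {..<N} x)"
        using j by (simp add: radial_projection_nth power_divide power_mult_distrib)
      then have "real N * (2 / 5) \<le> real N * ((x j)\<^sup>2 / sqnorm {..<N} x)" using True by simp
      then have "2 / 5 \<le> (x j)\<^sup>2 / sqnorm {..<N} x" using N by (subst (asm) mult_le_cancel_left_pos) auto
      then have le: "2 / 5 * sqnorm {..<N} x \<le> (x j)\<^sup>2" using q by (simp add: le_divide_eq)
      have "(\<Sum>i<N. (if i = j then 1 / 2 else - 1 / 3) * (x i)\<^sup>2) =
          (\<Sum>i<N. (if i = j then 5 / 6 * (x j)\<^sup>2 else 0) - 1 / 3 * (x i)\<^sup>2)"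
        by (intro sum.cong) auto
      also have "\<dots> = 5 / 6 * (x j)\<^sup>2 - 1 / 3 * sqnorm {..<N} x"
        unfolding sum_subtractf sqnorm_def sum_distrib_left using j by simp
      finally have "(\<Sum>i<N. (if i = j then 1 / 2 else - 1 / 3) * (x i)\<^sup>2) \<ge> 0"
        using le by simp
      then have "1 \<le> exp (\<Sum>i<N. (if i = j then 1 / 2 else - 1 / 3) * (x i)\<^sup>2)" by simp
      then show ?thesis using True by (simp add: exp_sum)
    next
      case False
      then show ?thesis by (simp add: prod_nonneg)
    qed
  qed (auto intro!: prod_nonneg)
  also have "\<dots> = (\<Prod>i<N. \<integral>x. exp ((if i = j then 1 / 2 else - 1 / 3) * x\<^sup>2) \<partial>tilted 0)"
  proof -
    interpret product_prob_space "\<lambda>i. tilted (if i = j then 0 else 0)" "{..<N}" by (rule product_prob_space_tilted)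
    show ?thesis
      unfolding tilted_product_def
      by (subst product_integral_prod)
        (use has_bochner_integral_tilted_exp_square[of "1/2"] has_bochner_integral_tilted_exp_square[of "- 1/3"] in
          \<open>auto simp: has_bochner_integral_iff\<close>)
  qed
  \<comment> \<open>The values are 1 / sqrt (1 - 1/2) and 1 / sqrt (1 + 1/3). The decay sqrt (3/4)
    is fast enough to absorb the growth sqrt (5/4) of exp (\<beta>) in the final choice of
    \<beta>.\<close>
  also have "\<dots> = (\<Prod>i<N. if i = j then sqrt 2 else sqrt (3 / 4))"
    using has_bochner_integral_tilted_exp_square[of "1/2"] has_bochner_integral_tilted_exp_square[of "- 1/3"]
    by (intro prod.cong) (auto simp: has_bochner_integral_iff real_sqrt_divide)
  also have "\<dots> = sqrt 2 * (\<Prod>i\<in>{..<N} - {j}. sqrt (3 / 4))"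
    using j by (subst prod.remove[of _ j]) (auto intro!: prod.cong)
  also have "\<dots> = sqrt 2 * sqrt (3 / 4) ^ (N - 1)"
    using j by simp
  finally show ?thesis .
qed

lemma power_sum_density_bounded:
  assumes N: "N \<ge> 1"
  shows "\<exists>K. \<forall>v\<in>kac_sphere N. 0 < power_sum_density N v \<and> power_sum_density N v \<le> K"
proof -
  let ?Z = "\<integral>v. (\<Sum>i<N. \<bar>v i\<bar> ^ N) \<partial>sphere_measure N"
  have Z: "?Z > 0" using integral_power_sum_density(2)[OF N, of "\<lambda>_. 0" 0] by simp
  have "0 < power_sum_density N v \<and> power_sum_density N v \<le> (\<Sum>i<N. sqrt (real N) ^ N) / ?Z"
    if v: "v \<in> kac_sphere N" for v
    unfolding power_sum_density_def
    using Z kac_sphere_power_sum_pos[OF N v] kac_sphere_abs_le[OF v]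
    by (intro conjI divide_pos_pos divide_right_mono sum_mono power_mono) auto
  then show ?thesis by blast
qed

text \<open>
  Integrates \<open>G ln G \<ge> G q + G - exp q\<close>, where \<open>q\<close> is \<open>\<beta> N\<close> if some coordinate is large
  and \<open>0\<close> otherwise.
\<close>

lemma power_sum_entropy_lower_bound:
  assumes N: "N \<ge> 1" and \<beta>: "\<beta> \<ge> 0"
  obtains H where "sphere_entropy N (power_sum_density N) = ereal H"
    "H \<ge> \<beta> * real N * (1 - 1100 / real N) - exp (\<beta> * real N) * (real N * (sqrt 2 * sqrt (3 / 4) ^ (N - 1)))"
proof -
  let ?\<sigma> = "sphere_measure N" and ?\<pi> = "radial_projection N"
  interpret prob_space ?\<sigma> by (rule prob_space_sphere_measure[OF N])
  define G where "G = power_sum_density N"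
  have G_meas[measurable]: "G \<in> borel_measurable (Pi\<^sub>M {..<N} (\<lambda>_. borel))" unfolding G_def by measurable
  obtain K where K: "\<And>v. v \<in> kac_sphere N \<Longrightarrow> 0 < G v \<and> G v \<le> K"
    using power_sum_density_bounded[OF N] unfolding G_def by blast
  define A where "A j v = (indicator {2 / 5 * real N..} ((v j)\<^sup>2) :: real)" for j and v :: "nat \<Rightarrow> real"
  \<comment> \<open>The indicator that no coordinate is large, written as a product to make it
    measurable.\<close>
  define U where "U v = (\<Prod>j<N. 1 - A j v)" for v :: "nat \<Rightarrow> real"
  have A_meas[measurable]: "A j \<in> borel_measurable (Pi\<^sub>M {..<N} (\<lambda>_. borel))" if "j < N" for j
    using PiM_nth_measurable[OF that] unfolding A_def[abs_def] by measurable
  have U_meas: "U \<in> borel_measurable (Pi\<^sub>M {..<N} (\<lambda>_. borel))"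
    unfolding U_def[abs_def] by (intro borel_measurable_prod borel_measurable_diff A_meas) auto
  have A01: "A j v = 0 \<or> A j v = 1" for j v by (simp add: A_def indicator_def)
  have U01: "U v = (if \<forall>j<N. A j v = 0 then 1 else 0)" for v
  proof (cases "\<forall>j<N. A j v = 0")
    case False
    then obtain j where "j < N" "A j v = 1" using A01 by blast
    then have "U v = 0" unfolding U_def by (intro prod_zero) auto
    then show ?thesis using False by simp
  qed (simp add: U_def)
  have GU: "has_bochner_integral ?\<sigma> (\<lambda>v. G v * U v)
      ((\<Sum>j<N. \<integral>x. U (?\<pi> x) \<partial>tilted_product {..<N} N j) / real N)"
    unfolding G_def by (rule integral_power_sum_density(1)[OF N U_meas, of 1]) (simp add: U01)
  \<comment> \<open>In the j-th component of the mixture it suffices to look at the tilted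
    coordinate: U is at most 1 - A j.\<close>
  have "(\<integral>x. U (?\<pi> x) \<partial>tilted_product {..<N} N j) \<le> 1100 / real N" if j: "j < N" for j
  proof -
    interpret T: prob_space "tilted_product {..<N} N j" by (rule prob_space_tilted_product)
    have eq: "1 - A j v = indicator {v. (v j)\<^sup>2 < 2 / 5 * real N} v" for v
      by (auto simp: A_def indicator_def)
    have m: "(\<lambda>x. 1 - A j (?\<pi> x)) \<in> borel_measurable (Pi\<^sub>M {..<N} (\<lambda>_. borel))"
      by (intro borel_measurable_diff borel_measurable_const measurable_compose[OF radial_projection_measurable A_meas[OF j]])
    have "integrable (tilted_product {..<N} N j) (\<lambda>x. 1 - A j (?\<pi> x))"
    proof (rule T.integrable_const_bound[of _ 1])
      show "AE x in tilted_product {..<N} N j. norm (1 - A j (?\<pi> x)) \<le> 1"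
        using A01 by (intro AE_I2) (smt (verit) real_norm_def)
    qed (use m in measurable)
    then have "(\<integral>x. U (?\<pi> x) \<partial>tilted_product {..<N} N j) \<le> (\<integral>x. 1 - A j (?\<pi> x) \<partial>tilted_product {..<N} N j)"
    proof (rule integral_mono')
      fix x
      show "0 \<le> 1 - A j (?\<pi> x)" "U (?\<pi> x) \<le> 1 - A j (?\<pi> x)"
        using A01[of j "?\<pi> x"] j by (auto simp: U01)
    qed
    also have "\<dots> \<le> 1100 / real N"
      unfolding eq by (rule tilted_product_coordinate_concentration[OF j])
    finally show ?thesis .
  qed
  then have "(\<Sum>j<N. \<integral>x. U (?\<pi> x) \<partial>tilted_product {..<N} N j) \<le> (\<Sum>j<N. 1100 / real N)"
    by (intro sum_mono) auto
  then have "(\<Sum>j<N. \<integral>x. U (?\<pi> x) \<partial>tilted_product {..<N} N j) / real N \<le> (\<Sum>j<N. 1100 / real N) / real N"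
    by (rule divide_right_mono) simp
  also have "(\<Sum>j<N. 1100 / real N) / real N = 1100 / real N" using N by simp
  finally have GU_le: "(\<integral>v. G v * U v \<partial>?\<sigma>) \<le> 1100 / real N"
    unfolding has_bochner_integral_integral_eq[OF GU] .
  have G1: "has_bochner_integral ?\<sigma> G 1"
  proof -
    have "has_bochner_integral ?\<sigma> (\<lambda>v. G v * 1) ((\<Sum>j<N. \<integral>x. 1 \<partial>tilted_product {..<N} N j) / real N)"
      unfolding G_def by (rule integral_power_sum_density(1)[OF N, of "\<lambda>_. 1" 1]) auto
    then show ?thesis using N by (simp add: prob_space.prob_space[OF prob_space_tilted_product])
  qed
  have A_int: "integrable ?\<sigma> (A j)" if "j < N" for j
    using A01 by (intro integrable_sphere_bounded[OF N A_meas[OF that], of 1]) (smt (verit))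
  have A_le: "(\<integral>v. A j v \<partial>?\<sigma>) \<le> sqrt 2 * sqrt (3 / 4) ^ (N - 1)" if "j < N" for j
  proof -
    have "A j = indicator {v. 2 / 5 * real N \<le> (v j)\<^sup>2}" by (auto simp: A_def indicator_def)
    then show ?thesis using sphere_coordinate_tail[OF that] by simp
  qed
  \<comment> \<open>The lower bound G q + G - exp q, with exp q replaced by its union bound 1 + exp
    (\<beta> N) times the sum of the \<open>A j\<close>.\<close>
  define R where "R v = \<beta> * real N * G v - \<beta> * real N * (G v * U v) + G v - 1 - exp (\<beta> * real N) * (\<Sum>j<N. A j v)" for v
  have "has_bochner_integral ?\<sigma> R (\<beta> * real N * 1 - \<beta> * real N * (\<integral>v. G v * U v \<partial>?\<sigma>) + 1 - 1
      - exp (\<beta> * real N) * (\<Sum>j<N. \<integral>v. A j v \<partial>?\<sigma>))"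
    unfolding R_def
    by (intro has_bochner_integral_diff has_bochner_integral_add has_bochner_integral_mult_right
        has_bochner_integral_sum G1 has_bochner_integral_const has_bochner_integral_integrable A_int
        integrable.intros[OF GU]) auto
  note R = this
  have pointwise: "R v \<le> G v * ln (G v)" if v: "v \<in> kac_sphere N" for v
  proof -
    define q where "q = \<beta> * real N * (1 - U v)"
    have G0: "G v > 0" using K[OF v] by simp
    \<comment> \<open>The inequality ln t \<le> t - 1 at t = exp q / G, multiplied by G.\<close>
    have "ln (exp q / G v) \<le> exp q / G v - 1" using G0 by (intro ln_le_minus_one) simp
    then have "q - ln (G v) \<le> exp q / G v - 1" using G0 by (simp add: ln_div)
    then have "(q - ln (G v)) * G v \<le> (exp q / G v - 1) * G v" using G0 by (intro mult_right_mono) auto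
    moreover have "(exp q / G v - 1) * G v = exp q - G v" using G0 by (simp add: left_diff_distrib)
    ultimately have "G v * q + G v - exp q \<le> G v * ln (G v)" by (simp only: left_diff_distrib) (simp add: mult_ac)
    moreover have "exp q \<le> 1 + exp (\<beta> * real N) * (\<Sum>j<N. A j v)"
    proof (cases "\<forall>j<N. A j v = 0")
      case True
      then show ?thesis by (simp add: q_def U01)
    next
      case False
      then obtain j where j: "j < N" "A j v = 1" using A01 by blast
      have "A j v \<le> (\<Sum>j<N. A j v)" using j by (intro member_le_sum) (auto simp: A_def)
      then have *: "exp (\<beta> * real N) * 1 \<le> exp (\<beta> * real N) * (\<Sum>j<N. A j v)"
        using j by (intro mult_left_mono) auto
      have "U v = 0" unfolding U01 using False by (rule if_not_P)
      then have q: "q = \<beta> * real N" by (simp add: q_def)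
      show ?thesis using * unfolding q mult_1_right by linarith
    qed
    moreover have "G v * q = \<beta> * real N * G v - \<beta> * real N * (G v * U v)"
      by (simp add: q_def algebra_simps)
    ultimately show ?thesis unfolding R_def by linarith
  qed
  \<comment> \<open>G ln G is bounded: ln t \<le> t - 1 at t = G gives the upper bound K^2, and at t
    = 1 / G the lower bound - 1.\<close>
  have int: "integrable ?\<sigma> (\<lambda>v. G v * ln (G v))"
  proof (rule integrable_sphere_bounded[OF N, of _ "K * K + 1"])
    fix v assume v: "v \<in> kac_sphere N"
    have G0: "G v > 0" "G v \<le> K" using K[OF v] by auto
    have "G v * ln (G v) \<le> G v * G v" using ln_le_minus_one[OF G0(1)] G0 by (intro mult_left_mono) auto
    also have "\<dots> \<le> K * K" using G0 by (intro mult_mono) auto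
    finally have 1: "G v * ln (G v) \<le> K * K" .
    have "ln (1 / G v) \<le> 1 / G v - 1" using G0 by (intro ln_le_minus_one) simp
    then have "- ln (G v) * G v \<le> (1 / G v - 1) * G v" using G0 by (intro mult_right_mono) (auto simp: ln_div)
    moreover have "(1 / G v - 1) * G v = 1 - G v" using G0 by (simp add: left_diff_distrib)
    ultimately have "- 1 \<le> G v * ln (G v)" using G0 by (simp add: mult.commute)
    with 1 show "\<bar>G v * ln (G v)\<bar> \<le> K * K + 1"
      using zero_le_square[of K] by linarith
  qed measurable
  show ?thesis
  proof (rule that)
    show "sphere_entropy N (power_sum_density N) = ereal (\<integral>v. G v * ln (G v) \<partial>?\<sigma>)"
      unfolding sphere_entropy_def G_def[symmetric] by (rule ext_integral_eq_integral[OF int])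
    have "(\<Sum>j<N. \<integral>v. A j v \<partial>?\<sigma>) \<le> (\<Sum>j<N. sqrt 2 * sqrt (3 / 4) ^ (N - 1))"
      by (intro sum_mono A_le) auto
    then have "exp (\<beta> * real N) * (\<Sum>j<N. \<integral>v. A j v \<partial>?\<sigma>) \<le> exp (\<beta> * real N) * (real N * (sqrt 2 * sqrt (3 / 4) ^ (N - 1)))"
      by (intro mult_left_mono) auto
    moreover have "\<beta> * real N * (\<integral>v. G v * U v \<partial>?\<sigma>) \<le> \<beta> * real N * (1100 / real N)"
      using \<beta> by (intro mult_left_mono GU_le) auto
    moreover have "(\<integral>v. R v \<partial>?\<sigma>) \<le> (\<integral>v. G v * ln (G v) \<partial>?\<sigma>)"
      using R int pointwise by (intro integral_mono) (auto simp: has_bochner_integral_iff space_sphere_measure)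
    ultimately show "\<beta> * real N * (1 - 1100 / real N) - exp (\<beta> * real N) * (real N * (sqrt 2 * sqrt (3 / 4) ^ (N - 1)))
        \<le> (\<integral>v. G v * ln (G v) \<partial>?\<sigma>)"
      unfolding has_bochner_integral_integral_eq[OF R] right_diff_distrib by linarith
  qed
qed

text \<open>The log-ratio of the densities is ln 2 / 2 - x^2 / 2, and the second moment of
  \<open>tilted 0\<close> is 1/2.\<close>

lemma gaussian_relative_entropy_half:
  "gaussian_relative_entropy (tilted_density 0) = ereal (ln 2 / 2 - 1 / 4)"
proof -
  have e: "tilted_density 0 x * ln (tilted_density 0 x / std_normal_density x) =
      ln 2 / 2 * (exp (- x\<^sup>2) * \<bar>x\<bar> ^ 0 / sqrt pi) - 1 / 2 * (exp (- x\<^sup>2) * \<bar>x\<bar> ^ 2 / sqrt pi)" for x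
  proof -
    have "tilted_density 0 x / std_normal_density x = sqrt 2 * (exp (- x\<^sup>2) / exp (- x\<^sup>2 / 2))"
      by (simp add: tilted_density_0 std_normal_density_def real_sqrt_mult)
    also have "exp (- x\<^sup>2) / exp (- x\<^sup>2 / 2) = exp (- x\<^sup>2 / 2)"
      by (simp add: exp_diff[symmetric])
    finally have l: "ln (tilted_density 0 x / std_normal_density x) = ln 2 / 2 - x\<^sup>2 / 2"
      by (simp add: ln_mult ln_sqrt)
    show ?thesis unfolding l unfolding tilted_density_0 by (simp add: field_simps)
  qed
  have am: "abs_moment 2 = sqrt pi / 2" using abs_moment_add2[of 0] by (simp add: numeral_2_eq_2)
  have "has_bochner_integral lborel (\<lambda>x. ln 2 / 2 * (exp (- x\<^sup>2) * \<bar>x\<bar> ^ 0 / sqrt pi) - 1 / 2 * (exp (- x\<^sup>2) * \<bar>x\<bar> ^ 2 / sqrt pi))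
     (ln 2 / 2 * (sqrt pi / sqrt pi) - 1 / 2 * (sqrt pi / 2 / sqrt pi))"
    using has_bochner_integral_abs_moment[of 0, unfolded abs_moment_0] has_bochner_integral_abs_moment[of 2, unfolded am]
    by (intro has_bochner_integral_diff has_bochner_integral_mult_right has_bochner_integral_divide_zero)
  then show ?thesis
    unfolding gaussian_relative_entropy_def e
    by (subst ext_integral_eq_integral) (auto simp: has_bochner_integral_iff)
qed

text \<open>Equivalent to 8/5 < exp (1/2); the quadratic Taylor polynomial already gives
  13/8.\<close>

lemma ln_five_fourths_gt: "ln 2 / 2 - 1 / 4 < ln (5 / 4 :: real) / 2"
proof -
  have "(8 / 5 :: real) < 1 + 1 / 2 + (1 / 2)\<^sup>2 / 2" by (simp add: power2_eq_square)
  also have "\<dots> \<le> exp (1 / 2)" by (rule exp_lower_Taylor_quadratic) simp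
  finally have "ln (8 / 5 :: real) < ln (exp (1 / 2))" by (subst ln_less_cancel_iff) auto
  then have "ln (8 / 5 :: real) < 1 / 2" by simp
  moreover have "ln (2 / (5 / 4) :: real) = ln 2 - ln (5 / 4)"
    by (rule ln_divide_pos) auto
  ultimately show ?thesis by simp
qed

text \<open>The test functions cos (t x) and sin (t x) yield the characteristic functions, and
  Levy's uniqueness theorem applies.\<close>

lemma density_unique_continuous_test:
  fixes f g :: "real \<Rightarrow> real"
  assumes f: "real_density f" and g: "real_density g"
    and eq: "\<And>\<psi> :: real \<Rightarrow> real. continuous_on UNIV \<psi> \<Longrightarrow> bounded (range \<psi>) \<Longrightarrow>
      (\<integral>x. f x * \<psi> x \<partial>lborel) = (\<integral>x. g x * \<psi> x \<partial>lborel)"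
  shows "AE x in lborel. f x = g x"
proof -
  have meas: "h \<in> borel_measurable borel" if "real_density h" for h
    using that by (auto simp: real_density_def has_bochner_integral_iff)
  have dist: "real_distribution (density lborel (\<lambda>x. ennreal (h x)))" if h: "real_density h" for h
  proof (intro real_distribution.intro prob_spaceI real_distribution_axioms.intro)
    have "(\<integral>\<^sup>+x. ennreal (h x) \<partial>lborel) = ennreal 1"
      using h by (intro nn_integral_eq_integral[THEN trans]) (auto simp: real_density_def has_bochner_integral_iff)
    then show "emeasure (density lborel (\<lambda>x. ennreal (h x))) (space (density lborel (\<lambda>x. ennreal (h x)))) = 1"
      using meas[OF h] by (simp add: emeasure_density)
  qed simp
  have char: "Re (char (density lborel (\<lambda>x. ennreal (h x))) t) = (\<integral>x. h x * cos (t * x) \<partial>lborel)"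
    "Im (char (density lborel (\<lambda>x. ennreal (h x))) t) = (\<integral>x. h x * sin (t * x) \<partial>lborel)"
    if h: "real_density h" for h t
  proof -
    interpret real_distribution "density lborel (\<lambda>x. ennreal (h x))" by (rule dist[OF h])
    have [measurable]: "h \<in> borel_measurable borel" by (rule meas[OF h])
    have int: "integrable (density lborel (\<lambda>x. ennreal (h x))) (\<lambda>x. iexp (t * x))"
      by (rule integrable_iexp) auto
    have "Re (char (density lborel (\<lambda>x. ennreal (h x))) t) = (\<integral>x. Re (iexp (t * x)) \<partial>density lborel (\<lambda>x. ennreal (h x)))"
      unfolding char_def by (rule integral_Re[symmetric, OF int])
    also have "\<dots> = (\<integral>x. h x * cos (t * x) \<partial>lborel)"
      using h by (subst integral_density) (auto simp: real_density_def Re_exp)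
    finally show "Re (char (density lborel (\<lambda>x. ennreal (h x))) t) = (\<integral>x. h x * cos (t * x) \<partial>lborel)" .
    have "Im (char (density lborel (\<lambda>x. ennreal (h x))) t) = (\<integral>x. Im (iexp (t * x)) \<partial>density lborel (\<lambda>x. ennreal (h x)))"
      unfolding char_def by (rule integral_Im[symmetric, OF int])
    also have "\<dots> = (\<integral>x. h x * sin (t * x) \<partial>lborel)"
      using h by (subst integral_density) (auto simp: real_density_def Im_exp)
    finally show "Im (char (density lborel (\<lambda>x. ennreal (h x))) t) = (\<integral>x. h x * sin (t * x) \<partial>lborel)" .
  qed
  have "(\<integral>x. f x * cos (t * x) \<partial>lborel) = (\<integral>x. g x * cos (t * x) \<partial>lborel)"
    "(\<integral>x. f x * sin (t * x) \<partial>lborel) = (\<integral>x. g x * sin (t * x) \<partial>lborel)" for t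
    by (intro eq continuous_intros boundedI[of _ 1]; auto)+
  then have "char (density lborel (\<lambda>x. ennreal (f x))) = char (density lborel (\<lambda>x. ennreal (g x)))"
    by (intro ext complex_eqI) (simp_all add: char f g)
  then have "density lborel (\<lambda>x. ennreal (f x)) = density lborel (\<lambda>x. ennreal (g x))"
    by (intro Levy_uniqueness dist f g)
  then have "AE x in lborel. ennreal (f x) = ennreal (g x)"
    using meas[OF f] meas[OF g] by (intro sigma_finite_measure.density_unique[OF sigma_finite_lborel]) auto
  then show ?thesis
    using f g by (auto simp: real_density_def)
qed

section \<open>Symmetry, chaoticity and uniqueness of the limit density\<close>

lemma kac_sphere_permute:
  assumes "v \<in> kac_sphere N" "p permutes {..<N}"
  shows "v \<circ> p \<in> kac_sphere N"
proof -
  have "(\<Sum>i<N. (v (p i))\<^sup>2) = (\<Sum>i<N. (v i)\<^sup>2)"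
    using sum.permute[OF assms(2), of "\<lambda>i. (v i)\<^sup>2"] by (simp add: o_def)
  moreover have "p i = i" if "i \<notin> {..<N}" for i
    using assms(2) that by (rule permutes_not_in)
  ultimately show ?thesis
    using assms(1) by (auto simp: kac_sphere_def PiE_iff extensional_def)
qed

lemma symmetric_density_power_sum:
  assumes "N \<ge> 1"
  shows "symmetric_density N (power_sum_density N)"
  unfolding symmetric_density_def
proof (intro conjI ballI allI impI)
  show "0 \<le> power_sum_density N v" if "v \<in> kac_sphere N" for v
    using power_sum_density_bounded[OF assms] that by (auto intro: less_imp_le)
  have "has_bochner_integral (sphere_measure N) (\<lambda>v. power_sum_density N v * 1)
      ((\<Sum>j<N. \<integral>x. 1 \<partial>tilted_product {..<N} N j) / real N)"
    by (rule integral_power_sum_density(1)[OF assms, of "\<lambda>_. 1" 1]) auto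
  then show "has_bochner_integral (sphere_measure N) (power_sum_density N) 1"
    using assms by (simp add: prob_space.prob_space[OF prob_space_tilted_product])
  show "power_sum_density N (v \<circ> p) = power_sum_density N v" if "p permutes {..<N}" for v p
    using sum.permute[OF that, of "\<lambda>i. \<bar>v i\<bar> ^ N"] by (simp add: power_sum_density_def o_def)
qed

lemma real_density_tilted: "real_density (tilted_density p)"
  by (simp add: real_density_def tilted_density_integral)

lemma chaotic_power_sum_density: "chaotic (tilted_density 0) power_sum_density"
  unfolding chaotic_def
proof (intro conjI allI impI)
  fix k :: nat and \<phi> :: "(nat \<Rightarrow> real) \<Rightarrow> real"
  assume cont: "continuous_on ({..<k} \<rightarrow>\<^sub>E UNIV) \<phi>" and "bounded (\<phi> ` ({..<k} \<rightarrow>\<^sub>E UNIV))"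
  then obtain B where B: "\<And>x. x \<in> {..<k} \<rightarrow>\<^sub>E UNIV \<Longrightarrow> \<bar>\<phi> x\<bar> \<le> B"
    by (auto simp: bounded_iff)
  have "(\<integral>x. \<phi> x \<partial>Pi\<^sub>M {..<k} (\<lambda>_. tilted 0)) =
      (\<integral>x. (\<Prod>i<k. tilted_density 0 (x i)) *\<^sub>R \<phi> x \<partial>Pi\<^sub>M {..<k} (\<lambda>_. lborel))"
    unfolding PiM_tilted_eq_density[OF finite_lessThan, of k "\<lambda>_. 0"]
  proof (rule integral_density)
    show "\<phi> \<in> borel_measurable (Pi\<^sub>M {..<k} (\<lambda>_. lborel))"
      using continuous_on_PiE_measurable[OF cont] by (simp add: measurable_cong_sets[OF sets_PiM_lborel refl])
    have "(\<lambda>x. tilted_density 0 (x i)) \<in> borel_measurable (Pi\<^sub>M {..<k} (\<lambda>_. lborel))" if "i \<in> {..<k}" for i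
      by (rule measurable_compose[OF measurable_component_singleton[OF that]]) simp
    then show "(\<lambda>x. \<Prod>i<k. tilted_density 0 (x i)) \<in> borel_measurable (Pi\<^sub>M {..<k} (\<lambda>_. lborel))"
      by (rule borel_measurable_prod)
  qed (simp add: prod_nonneg)
  with power_sum_density_marginal_limit[OF cont B]
  show "(\<lambda>N. \<integral>v. power_sum_density N v * \<phi> (restrict v {..<k}) \<partial>sphere_measure N)
      \<longlonglongrightarrow> (\<integral>x. (\<Prod>i<k. tilted_density 0 (x i)) * \<phi> x \<partial>(\<Pi>\<^sub>M i\<in>{..<k}. lborel))"
    by simp
qed (auto simp: real_density_tilted symmetric_density_power_sum)

text \<open>The first marginal already determines the limit: bounded continuous functions of x 0
  alone are admissible tests for k = 1.\<close>

lemma chaotic_unique: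
  assumes "chaotic f F" "chaotic g F"
  shows "AE x in lborel. f x = g x"
proof (rule density_unique_continuous_test)
  show fg: "real_density f" "real_density g" using assms by (simp_all add: chaotic_def)
  fix \<psi> :: "real \<Rightarrow> real" assume \<psi>: "continuous_on UNIV \<psi>" "bounded (range \<psi>)"
  have meas: "\<psi> \<in> borel_measurable borel" using \<psi>(1) by (rule borel_measurable_continuous_onI)
  interpret product_sigma_finite "\<lambda>_::nat. lborel :: real measure" ..
  have int: "(\<integral>x. (\<Prod>i<1. h (x i)) * \<psi> (x 0) \<partial>(\<Pi>\<^sub>M i\<in>{..<1::nat}. lborel)) = (\<integral>x. h x * \<psi> x \<partial>lborel)"
    if "real_density h" for h
  proof -
    have "h \<in> borel_measurable borel" using that by (auto simp: real_density_def has_bochner_integral_iff)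
    then have "(\<lambda>x. h x * \<psi> x) \<in> borel_measurable lborel" using meas by simp
    then have "(\<integral>x. h (x 0) * \<psi> (x 0) \<partial>(\<Pi>\<^sub>M i\<in>{0::nat}. lborel)) = (\<integral>x. h x * \<psi> x \<partial>lborel)"
      by (rule product_integral_singleton)
    moreover have one: "{..<1} = {0::nat}" by auto
    ultimately show ?thesis unfolding one by simp
  qed
  have cont: "continuous_on ({..<1} \<rightarrow>\<^sub>E UNIV) (\<lambda>x :: nat \<Rightarrow> real. \<psi> (x 0))"
    by (rule continuous_on_compose2[OF \<psi>(1) continuous_on_subset[OF continuous_on_product_coordinates]]) auto
  have bdd: "bounded ((\<lambda>x :: nat \<Rightarrow> real. \<psi> (x 0)) ` ({..<1} \<rightarrow>\<^sub>E UNIV))"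
    by (rule bounded_subset[OF \<psi>(2)]) auto
  have lim: "(\<lambda>N. \<integral>v. F N v * \<psi> (restrict v {..<1} 0) \<partial>sphere_measure N) \<longlonglongrightarrow> (\<integral>x. h x * \<psi> x \<partial>lborel)"
    if "chaotic h F" "real_density h" for h
  proof -
    have "(\<lambda>N. \<integral>v. F N v * \<psi> (restrict v {..<1} 0) \<partial>sphere_measure N)
        \<longlonglongrightarrow> (\<integral>x. (\<Prod>i<1. h (x i)) * \<psi> (x 0) \<partial>(\<Pi>\<^sub>M i\<in>{..<1::nat}. lborel))"
      using that(1)[unfolded chaotic_def, THEN conjunct2, THEN conjunct2, rule_format, OF order_refl cont bdd] .
    then show ?thesis unfolding int[OF that(2)] .
  qed
  show "(\<integral>x. f x * \<psi> x \<partial>lborel) = (\<integral>x. g x * \<psi> x \<partial>lborel)"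
    by (rule LIMSEQ_unique[OF lim lim]) (use assms fg in auto)
qed

text \<open>The theorem fixes its family only for N \<ge> 1 and on the sphere. For the symmetry
  condition, \<open>kac_sphere_permute\<close> keeps the permuted point on the sphere.\<close>

lemma chaotic_cong:
  assumes "\<And>N v. N \<ge> 1 \<Longrightarrow> v \<in> kac_sphere N \<Longrightarrow> F N v = G N v"
  shows "chaotic f F \<longleftrightarrow> chaotic f G"
proof -
  have sym: "symmetric_density N (F N) \<longleftrightarrow> symmetric_density N (G N)" if N: "N \<ge> 1" for N
  proof -
    have "has_bochner_integral (sphere_measure N) (F N) 1 \<longleftrightarrow> has_bochner_integral (sphere_measure N) (G N) 1"
      by (rule has_bochner_integral_cong) (auto simp: space_sphere_measure assms[OF N])
    then show ?thesis
      unfolding symmetric_density_def by (auto simp: assms[OF N] kac_sphere_permute)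
  qed
  have "(\<lambda>N. \<integral>v. F N v * \<phi> (restrict v {..<k}) \<partial>sphere_measure N) \<longlonglongrightarrow> L \<longleftrightarrow>
      (\<lambda>N. \<integral>v. G N v * \<phi> (restrict v {..<k}) \<partial>sphere_measure N) \<longlonglongrightarrow> L" for k \<phi> L
  proof (rule tendsto_cong, rule eventually_mono[OF eventually_ge_at_top[of 1]])
    fix N :: nat assume N: "N \<ge> 1"
    show "(\<integral>v. F N v * \<phi> (restrict v {..<k}) \<partial>sphere_measure N) = (\<integral>v. G N v * \<phi> (restrict v {..<k}) \<partial>sphere_measure N)"
      by (intro Bochner_Integration.integral_cong) (auto simp: space_sphere_measure assms[OF N])
  qed
  then show ?thesis using sym unfolding chaotic_def by simp
qed

lemma sphere_entropy_cong:
  assumes "\<And>v. v \<in> kac_sphere N \<Longrightarrow> F v = G v"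
  shows "sphere_entropy N F = sphere_entropy N G"
  unfolding sphere_entropy_def
  by (intro ext_integral_cong_AE AE_I2) (simp add: space_sphere_measure assms)

text \<open>A lower bound on the entropy suffices. With \<beta> = ln (5/4) / 2 the error term decays
  like sqrt (15/16)^N, so every limit of the entropy per coordinate is at least \<beta>, which is
  too large. The admissible \<beta> lie strictly between ln 2 / 2 - 1/4 and ln (4/3) / 2.\<close>

lemma power_sum_entropy_not_limit:
  "\<not> (\<lambda>N. sphere_entropy N (power_sum_density N) / ereal (real N)) \<longlonglongrightarrow> ereal (ln 2 / 2 - 1 / 4)"
proof
  assume lim: "(\<lambda>N. sphere_entropy N (power_sum_density N) / ereal (real N)) \<longlonglongrightarrow> ereal (ln 2 / 2 - 1 / 4)"
  define b :: "nat \<Rightarrow> real" where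
    "b N = ln (5 / 4) / 2 * (1 - 1100 / real N) - exp (ln (5 / 4) / 2 * real N) * (sqrt 2 * sqrt (3 / 4) ^ (N - 1))" for N
  have "ereal (b N) \<le> sphere_entropy N (power_sum_density N) / ereal (real N)" if N: "N \<ge> 1" for N
  proof -
    obtain H where H: "sphere_entropy N (power_sum_density N) = ereal H"
      "H \<ge> ln (5 / 4) / 2 * real N * (1 - 1100 / real N) -
        exp (ln (5 / 4) / 2 * real N) * (real N * (sqrt 2 * sqrt (3 / 4) ^ (N - 1)))"
      using power_sum_entropy_lower_bound[OF N, of "ln (5 / 4) / 2"] by auto
    have "b N * real N \<le> H"
      using H(2) unfolding b_def by (simp only: right_diff_distrib left_diff_distrib mult_ac)
    then show ?thesis using N H(1) by (simp add: le_divide_eq)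
  qed
  then have "\<forall>\<^sub>F N in sequentially. ereal (b N) \<le> sphere_entropy N (power_sum_density N) / ereal (real N)"
    by (intro eventually_mono[OF eventually_ge_at_top[of 1]])
  moreover have "b \<longlonglongrightarrow> ln (5 / 4) / 2"
  proof -
    have e: "exp (ln (5 / 4) / 2 * real N) * (sqrt 2 * sqrt (3 / 4) ^ (N - 1)) =
        sqrt 2 / sqrt (3 / 4) * sqrt (15 / 16) ^ N" if N: "N \<ge> 1" for N
    proof -
      have "ln (sqrt (5 / 4 :: real)) = ln (5 / 4) / 2" by (rule ln_sqrt) simp
      then have "exp (ln (5 / 4 :: real) / 2) = sqrt (5 / 4)"
        by (metis exp_ln real_sqrt_gt_zero zero_less_divide_iff zero_less_numeral)
      then have 1: "exp (ln (5 / 4) / 2 * real N) = sqrt (5 / 4) ^ N" by (simp only: exp_of_nat2_mult)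
      have 2: "sqrt (3 / 4) ^ (N - 1) = sqrt (3 / 4) ^ N / sqrt (3 / 4)"
        using N by (cases N) auto
      have "sqrt (5 / 4) ^ N * sqrt (3 / 4) ^ N = sqrt (15 / 16) ^ N"
        by (simp add: power_mult_distrib[symmetric] real_sqrt_mult[symmetric])
      then show ?thesis unfolding 1 2 by (simp add: mult_ac)
    qed
    have "(\<lambda>N. sqrt (15 / 16 :: real) ^ N) \<longlonglongrightarrow> 0"
      by (rule LIMSEQ_realpow_zero) auto
    then have "(\<lambda>N. sqrt 2 / sqrt (3 / 4) * sqrt (15 / 16 :: real) ^ N) \<longlonglongrightarrow> 0"
      by (rule tendsto_mult_right_zero)
    moreover have "\<forall>\<^sub>F N in sequentially. sqrt 2 / sqrt (3 / 4) * sqrt (15 / 16 :: real) ^ N =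
        exp (ln (5 / 4) / 2 * real N) * (sqrt 2 * sqrt (3 / 4) ^ (N - 1))"
      by (rule eventually_mono[OF eventually_ge_at_top[of 1]]) (rule e[symmetric])
    ultimately have 1: "(\<lambda>N. exp (ln (5 / 4) / 2 * real N) * (sqrt 2 * sqrt (3 / 4) ^ (N - 1))) \<longlonglongrightarrow> 0"
      by (rule Lim_transform_eventually)
    have "(\<lambda>N. ln (5 / 4) / 2 * (1 - 1100 / real N)) \<longlonglongrightarrow> ln (5 / 4) / 2 * (1 - 0)"
      by (intro tendsto_intros lim_const_over_n)
    from tendsto_diff[OF this 1] show ?thesis by (simp add: b_def[abs_def])
  qed
  then have "(\<lambda>N. ereal (b N)) \<longlonglongrightarrow> ereal (ln (5 / 4) / 2)" by simp
  ultimately have "ereal (ln (5 / 4) / 2) \<le> ereal (ln 2 / 2 - 1 / 4)"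
    using tendsto_le[OF sequentially_bot lim] by blast
  then show False using ln_five_fourths_gt by simp
qed

theorem theorem1p8:
  fixes Z :: "nat \<Rightarrow> real" and F :: "nat \<Rightarrow> (nat \<Rightarrow> real) \<Rightarrow> real"
  assumes "\<And>N. N \<ge> 1 \<Longrightarrow> Z N = (\<integral>v. (\<Sum>i<N. \<bar>v i\<bar> ^ N) \<partial>sphere_measure N)"
    and "\<And>N v. N \<ge> 1 \<Longrightarrow> v \<in> kac_sphere N \<Longrightarrow> F N v = (\<Sum>i<N. \<bar>v i\<bar> ^ N) / Z N"
  shows "chaotic (\<lambda>v. exp (- (v\<^sup>2)) / sqrt pi) F \<and> \<not> (\<exists>f. entropically_chaotic f F)"
proof -
  have F: "F N v = power_sum_density N v" if "N \<ge> 1" "v \<in> kac_sphere N" for N v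
    using assms that by (simp add: power_sum_density_def)
  have ch: "chaotic (tilted_density 0) F"
    using chaotic_power_sum_density chaotic_cong[of F power_sum_density] F by blast
  have "\<not> entropically_chaotic f F" for f
  proof
    assume e: "entropically_chaotic f F"
    \<comment> \<open>An arbitrary candidate f agrees almost everywhere with the Gaussian limit, and
      the relative entropy sees f only up to null sets.\<close>
    then have ae: "AE x in lborel. f x = tilted_density 0 x"
      using chaotic_unique[OF _ ch] by (simp add: entropically_chaotic_def)
    have "gaussian_relative_entropy f = gaussian_relative_entropy (tilted_density 0)"
      unfolding gaussian_relative_entropy_def
      by (rule ext_integral_cong_AE) (use ae in \<open>eventually_elim, simp\<close>)
    with e have "(\<lambda>N. sphere_entropy N (F N) / ereal (real N)) \<longlonglongrightarrow> ereal (ln 2 / 2 - 1 / 4)"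
      by (simp add: entropically_chaotic_def gaussian_relative_entropy_half)
    moreover have "\<forall>\<^sub>F N in sequentially. sphere_entropy N (F N) / ereal (real N) =
        sphere_entropy N (power_sum_density N) / ereal (real N)"
      by (rule eventually_mono[OF eventually_ge_at_top[of 1]])
         (simp add: F cong: sphere_entropy_cong)
    ultimately have "(\<lambda>N. sphere_entropy N (power_sum_density N) / ereal (real N)) \<longlonglongrightarrow> ereal (ln 2 / 2 - 1 / 4)"
      by (rule Lim_transform_eventually)
    then show False using power_sum_entropy_not_limit by blast
  qed
  moreover have "tilted_density 0 = (\<lambda>v. exp (- (v\<^sup>2)) / sqrt pi)"
    by (simp add: fun_eq_iff tilted_density_0)
  ultimately show ?thesis using ch by simp
qed

end
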